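(* Let $\alpha>0$ and put $k=\theta_2(e^{-\pi\alpha^2})^2/\theta_3(e^{-\pi\alpha^2})^2$ and $k'=\theta_4(e^{-\pi\alpha^2})^2/\theta_3(e^{-\pi\alpha^2})^2$ (so $k,k'\in(0,1)$ and $k^2+k'^2=1$). Let $A(\alpha;1)=\min_{(x,y)\in\mathbb{R}^2}p_\alpha(x,y;1)$ and $B(\alpha;1)=\max_{(x,y)\in\mathbb{R}^2}p_\alpha(x,y;1)$. Then $$A(\alpha;1)=\theta_4(e^{-\pi\alpha^2})\theta_4(e^{-\pi\alpha^{-2}})=\theta_2(e^{-\pi\alpha^2})\theta_2(e^{-\pi\alpha^{-2}})=\sqrt{k\,k'\,{}_2F_1\!\left(\tfrac12,\tfrac12;1;k^2\right){}_2F_1\!\left(\tfrac12,\tfrac12;1;k'^2\right)},$$ $$B(\alpha;1)=\theta_3(e^{-\pi\alpha^2})\theta_3(e^{-\pi\alpha^{-2}})=\sqrt{{}_2F_1\!\left(\tfrac12,\tfrac12;1;k^2\right){}_2F_1\!\left(\tfrac12,\tfrac12;1;k'^2\right)}.$$ In particular, $A(\alpha;1)$ and $B(\alpha;1)$ depend on $\alpha$ only through $k'$, and $\alpha\mapsto k'$ is a bijection from $\mathbb{R}_+$ onto $(0,1)$.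
   Context: For $\alpha>0$, $t>0$, $(x,y)\in\mathbb{R}^2$: $p_\alpha(x,y;t)=\sum_{(k,l)\in\mathbb{Z}^2}e^{-\pi t(\alpha^2k^2+\alpha^{-2}l^2)}e^{2\pi i(kx+ly)}$ is the (rescaled) heat kernel of the rectangular torus $\mathbb{R}^2/(\alpha^{-1}\mathbb{Z}\times\alpha\mathbb{Z})$ of area 1. Theta-nulls for $0<q<1$: $\theta_2(q)=\sum_{k\in\mathbb{Z}} q^{(k+1/2)^2}$, $\theta_3(q)=\sum_{k\in\mathbb{Z}} q^{k^2}$, $\theta_4(q)=\sum_{k\in\mathbb{Z}}(-1)^k q^{k^2}$. ${}_2F_1(a,b;c;x)=\sum_{n\ge0}\frac{(a)_n(b)_n}{(c)_n}\frac{x^n}{n!}$, $(z)_n=\Gamma(z+n)/\Gamma(z)$. *)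

theory Defs
  imports "HOL-Analysis.Analysis"
begin

definition theta2 :: "real \<Rightarrow> real" where
  "theta2 q = (\<Sum>\<^sub>\<infinity>k::int. q powr ((real_of_int k + 1/2)^2))"

definition theta3 :: "real \<Rightarrow> real" where
  "theta3 q = (\<Sum>\<^sub>\<infinity>k::int. q powr ((real_of_int k)^2))"

definition theta4 :: "real \<Rightarrow> real" where
  "theta4 q = (\<Sum>\<^sub>\<infinity>k::int. (-1) ^ nat \<bar>k\<bar> * q powr ((real_of_int k)^2))"

definition hyp2F1 :: "real \<Rightarrow> real \<Rightarrow> real \<Rightarrow> real \<Rightarrow> real" where
  "hyp2F1 a b c x = (\<Sum>n. pochhammer a n * pochhammer b n / pochhammer c n * x ^ n / fact n)"

text \<open>Rescaled heat kernel of the rectangular torus of area 1.\<close>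
definition heat_kernel :: "real \<Rightarrow> real \<Rightarrow> real \<Rightarrow> real \<Rightarrow> complex" where
  "heat_kernel \<alpha> x y t =
     (\<Sum>\<^sub>\<infinity>(k,l)\<in>(UNIV :: (int \<times> int) set).
        complex_of_real (exp (- pi * t * (\<alpha>^2 * (real_of_int k)^2 + \<alpha> powr (-2) * (real_of_int l)^2)))
        * cis (2 * pi * (real_of_int k * x + real_of_int l * y)))"

definition is_min_value :: "('a \<Rightarrow> real) \<Rightarrow> real \<Rightarrow> bool" where
  "is_min_value f V \<longleftrightarrow> (\<exists>z. f z = V) \<and> (\<forall>z. V \<le> f z)"

definition is_max_value :: "('a \<Rightarrow> real) \<Rightarrow> real \<Rightarrow> bool" where
  "is_max_value f V \<longleftrightarrow> (\<exists>z. f z = V) \<and> (\<forall>z. f z \<le> V)"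

definition modk :: "real \<Rightarrow> real" where
  "modk \<alpha> = theta2 (exp (- pi * \<alpha>^2))^2 / theta3 (exp (- pi * \<alpha>^2))^2"

definition modk' :: "real \<Rightarrow> real" where
  "modk' \<alpha> = theta4 (exp (- pi * \<alpha>^2))^2 / theta3 (exp (- pi * \<alpha>^2))^2"

end

theory Submission
  imports Defs
begin

text \<open>
  The heat kernel at \<open>t = 1\<close> is a product of two one-dimensional theta functions, so everything
  reduces to these. No Poisson summation is needed: all modular information is extracted from
  the doubling \<open>q \<mapsto> q\<^sup>2\<close> of the nome.

  Write \<open>F(x)\<close> for the hypergeometric function with parameters \<open>1/2, 1/2, 1\<close>. The doubling
  formulas for the theta-nulls match Landen's transformation
  \<open>F(4x/(1+x)\<^sup>2) = (1+x) F(x\<^sup>2)\<close>, so \<open>\<theta>\<^sub>3(q)\<^sup>2 / F(k\<^sup>2)\<close> is invariant under doubling and equals its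
  limit 1 at \<open>q = 0\<close>. Likewise \<open>F(1 - k\<^sup>2) / F(k\<^sup>2)\<close> doubles with \<open>q \<mapsto> q\<^sup>2\<close>, and the logarithmic
  growth of \<open>F\<close> at 1 identifies it as \<open>- ln q / \<pi>\<close>, that is \<open>\<alpha>\<^sup>2\<close>. As this ratio is strictly
  decreasing in \<open>k\<close>, the modulus is a bijective function of \<open>\<alpha>\<close>, and \<open>\<alpha> \<mapsto> 1/\<alpha>\<close> exchanges \<open>k\<close> and \<open>k'\<close>.

  For the minimum, let \<open>f\<^sub>q(x) = \<Sum> q\<^bsup>n\<^sup>2\<^esup> cos (2\<pi>nx)\<close>. The product formulas show that a bound
  \<open>f\<^sub>Q \<ge> c \<theta>\<^sub>4(Q)\<close> for \<open>Q = q\<^sup>2\<close> improves to \<open>f\<^sub>q \<ge> \<surd>c \<theta>\<^sub>4(q)\<close>; iterating from a crude bound near \<open>q = 0\<close>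
  gives \<open>f\<^sub>q \<ge> \<theta>\<^sub>4(q)\<close>.
\<close>

section \<open>The hypergeometric series\<close>

text \<open>Coefficients of 2/pi times the complete elliptic integral K(k) as a power series in
  k^2.\<close>

definition ellc :: "nat \<Rightarrow> real" where
  "ellc n = (pochhammer (1/2) n / fact n)\<^sup>2"

abbreviation (input) ellF :: "real \<Rightarrow> real" where
  "ellF \<equiv> hyp2F1 (1/2) (1/2) 1"

lemma ellF_eq: "ellF x = (\<Sum>n. ellc n * x ^ n)"
  by (simp add: hyp2F1_def ellc_def pochhammer_fact[symmetric] power2_eq_square field_simps)

lemma ellc_0 [simp]: "ellc 0 = 1"
  by (simp add: ellc_def)

lemma ellc_Suc: "ellc (Suc n) = ((2 * real n + 1) / (2 * real n + 2))\<^sup>2 * ellc n"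
  unfolding ellc_def power_mult_distrib[symmetric] 
  by (rule arg_cong[where f = "\<lambda>x. x\<^sup>2"]) (simp add: pochhammer_Suc field_simps)

lemma ellc_rec: "(real n + 1)\<^sup>2 * ellc (Suc n) = (real n + 1/2)\<^sup>2 * ellc n"
proof -
  have "(2 * real n + 2)\<^sup>2 * ellc (Suc n) = (2 * real n + 1)\<^sup>2 * ellc n"
    by (simp add: ellc_Suc power_divide)
  moreover have "(2 * real n + 2)\<^sup>2 = 4 * (real n + 1)\<^sup>2" "(2 * real n + 1)\<^sup>2 = 4 * (real n + 1/2)\<^sup>2"
    by (simp_all add: power2_eq_square algebra_simps)
  ultimately show ?thesis by simp
qed

lemma ellc_pos: "ellc n > 0"
  by (induction n) (auto simp: ellc_Suc)

lemma ellc_le_1: "ellc n \<le> 1"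
proof (induction n)
  case (Suc n)
  have "((2 * real n + 1) / (2 * real n + 2))\<^sup>2 \<le> 1"
    by (intro power_le_one) (auto simp: field_simps)
  then show ?case
    using Suc ellc_pos[of n] by (simp add: ellc_Suc mult_le_one)
qed simp

text \<open>The partial products in Wallis's formula are exactly the reciprocals of these
  terms.\<close>

lemma ellc_wallis: "(\<lambda>n. (2 * real n + 1) * ellc n) \<longlonglongrightarrow> 2 / pi"
proof -
  have eq: "(\<Prod>k=1..n. (4 * real k ^ 2) / (4 * real k ^ 2 - 1)) = inverse ((2 * real n + 1) * ellc n)" for n
  proof (induction n)
    case (Suc n)
    have "4 * real (Suc n) ^ 2 - 1 = (2 * real n + 1) * (2 * real n + 3)"
      by (simp add: power2_eq_square algebra_simps)
    moreover have "4 * real (Suc n) ^ 2 = (2 * real n + 2)^2"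
      by (simp add: power2_eq_square algebra_simps)
    ultimately have "(\<Prod>k=1..Suc n. (4 * real k ^ 2) / (4 * real k ^ 2 - 1)) =
        inverse ((2 * real n + 1) * ellc n) * ((2 * real n + 2)^2 / ((2 * real n + 1) * (2 * real n + 3)))"
      using Suc by (simp only: prod.cl_ivl_Suc) simp
    also have "\<dots> = inverse ((2 * real (Suc n) + 1) * ellc (Suc n))"
      by (simp add: ellc_Suc power_divide divide_inverse power2_eq_square mult_ac add_ac)
    finally show ?case .
  qed simp
  have "(\<lambda>n. inverse (inverse ((2 * real n + 1) * ellc n))) \<longlonglongrightarrow> inverse (pi / 2)"
    using wallis unfolding eq by (intro tendsto_inverse) auto
  then show ?thesis by simp
qed

text \<open>The sequence in \<open>ellc_wallis\<close> decreases, so it stays above its limit 2/pi;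
  replacing 2n + 1 by 2n + 2 only weakens the bound.\<close>

lemma ellc_lower: "1 / (pi * (real n + 1)) \<le> ellc n"
proof -
  have "decseq (\<lambda>n. (2 * real n + 1) * ellc n)"
  proof (rule decseq_SucI)
    fix n
    have "(2 * real (Suc n) + 1) * (2 * real n + 1)\<^sup>2 \<le> (2 * real n + 1) * (2 * real n + 2)\<^sup>2"
      by (simp add: power2_eq_square algebra_simps)
    then have "(2 * real (Suc n) + 1) * ((2 * real n + 1) / (2 * real n + 2))\<^sup>2 \<le> 2 * real n + 1"
      by (simp add: power_divide divide_simps)
    from mult_right_mono[OF this less_imp_le[OF ellc_pos[of n]]]
    show "(2 * real (Suc n) + 1) * ellc (Suc n) \<le> (2 * real n + 1) * ellc n"
      by (simp add: ellc_Suc mult.assoc)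
  qed
  then have "2 / pi \<le> (2 * real n + 1) * ellc n"
    using decseq_ge ellc_wallis by blast
  also have "\<dots> \<le> 2 * (real n + 1) * ellc n"
    using ellc_pos[of n] by (intro mult_right_mono) auto
  finally have "1 / pi \<le> ellc n * (real n + 1)" by (simp add: field_simps)
  then show ?thesis
    unfolding divide_divide_eq_left[symmetric] by (subst pos_divide_le_eq) auto
qed

text \<open>Here n times the coefficient increases, so it stays below its limit 1/pi, which again
  comes from Wallis.\<close>

lemma ellc_upper: "real n * ellc n \<le> 1 / pi"
proof -
  have "incseq (\<lambda>n. real n * ellc n)"
  proof (rule incseq_SucI)
    fix n
    have "real n * (2 * real n + 2)\<^sup>2 \<le> (real n + 1) * (2 * real n + 1)\<^sup>2"
      by (simp add: power2_eq_square algebra_simps)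
    then have "real n \<le> (real n + 1) * ((2 * real n + 1) / (2 * real n + 2))\<^sup>2"
      by (simp add: power_divide divide_simps)
    from mult_right_mono[OF this less_imp_le[OF ellc_pos[of n]]]
    show "real n * ellc n \<le> real (Suc n) * ellc (Suc n)"
      by (simp add: ellc_Suc algebra_simps)
  qed
  moreover have "(\<lambda>n. real n * ellc n) \<longlonglongrightarrow> 1 / pi"
  proof -
    have "(\<lambda>n. real n / (2 * real n + 1)) \<longlonglongrightarrow> 1 / 2"
    proof -
      have "(\<lambda>n. 1 / 2 - (1 / 2) * inverse (real (Suc (2 * n)))) \<longlonglongrightarrow> 1 / 2 - (1 / 2) * 0"
        by (intro tendsto_intros LIMSEQ_subseq_LIMSEQ[OF LIMSEQ_inverse_real_of_nat, of "\<lambda>n. 2 * n", unfolded o_def])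
          (auto simp: strict_mono_def)
      moreover have "1 / 2 - (1 / 2) * inverse (real (Suc (2 * n))) = real n / (2 * real n + 1)" for n
        by (simp add: divide_simps)
      ultimately show ?thesis by simp
    qed
    from tendsto_mult[OF this ellc_wallis] show ?thesis
      by (simp add: mult.assoc[symmetric])
  qed
  ultimately show ?thesis using incseq_le by blast
qed

lemma ellF_summable: "\<bar>x\<bar> < 1 \<Longrightarrow> summable (\<lambda>n. ellc n * x ^ n)"
proof (rule summable_comparison_test')
  show "summable (\<lambda>n. \<bar>x\<bar> ^ n)" if "\<bar>x\<bar> < 1" using that by (simp add: summable_geometric)
  show "norm (ellc n * x ^ n) \<le> \<bar>x\<bar> ^ n" if "n \<ge> 0" for n
    using mult_right_mono[OF ellc_le_1[of n], of "\<bar>x\<bar>^n"] ellc_pos[of n] by (simp add: abs_mult power_abs)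
qed

lemma ellF_0 [simp]: "ellF 0 = 1"
  by (simp add: ellF_eq powser_zero)

text \<open>The coefficients lie between 1/(pi (n + 1)) and 1/(pi n), so the series is compared
  termwise with that of - ln (1 - y) / pi. This fixes the constant 1/pi in the period ratio.\<close>

lemma ellF_log_bounds:
  assumes "0 \<le> y" "y < 1"
  shows "- ln (1 - y) / pi \<le> ellF y" "ellF y \<le> 1 - ln (1 - y) / pi"
proof -
  have L: "(\<lambda>n. y ^ Suc n / real (Suc n)) sums (- ln (1 - y))"
  proof -
    have "(\<lambda>n. y ^ n / real n) sums (- ln (1 - y))"
      using sums_minus[OF ln_series'[of "- y"]] assms by simp
    then show ?thesis by (subst sums_Suc_iff) simp
  qed
  have F: "(\<lambda>n. ellc n * y ^ n) sums ellF y"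
    unfolding ellF_eq by (rule summable_sums) (use assms in \<open>auto intro!: ellF_summable\<close>)
  show "- ln (1 - y) / pi \<le> ellF y"
  proof (rule sums_le[OF _ sums_divide[OF L] F])
    fix n
    \<comment> \<open>The logarithm series is aligned one power higher; the surplus factor y is at
      most 1.\<close>
    have "y ^ Suc n / real (Suc n) / pi = (1 / (pi * (real n + 1))) * y ^ n * y"
      by (simp add: field_simps)
    also have "\<dots> \<le> ellc n * y ^ n * 1"
      using assms ellc_lower[of n] by (intro mult_mono) (auto simp: ellc_pos less_imp_le)
    finally show "y ^ Suc n / real (Suc n) / pi \<le> ellc n * y ^ n" by simp
  qed
  \<comment> \<open>The upper coefficient bound says nothing at n = 0, so the constant term 1 is
    split off.\<close>
  have "(\<lambda>n. ellc (Suc n) * y ^ Suc n) sums (ellF y - 1)"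
    using F by (subst sums_Suc_iff) simp
  then have "ellF y - 1 \<le> - ln (1 - y) / pi"
  proof (rule sums_le[OF _ _ sums_divide[OF L], rotated])
    fix n
    have "ellc (Suc n) \<le> 1 / (real (Suc n) * pi)"
      using ellc_upper[of "Suc n"] unfolding mult.commute[of _ pi] divide_divide_eq_left[symmetric]
      by (subst pos_le_divide_eq) (auto simp: mult_ac)
    from mult_right_mono[OF this, of "y ^ Suc n"] assms
    show "ellc (Suc n) * y ^ Suc n \<le> y ^ Suc n / real (Suc n) / pi" by simp
  qed
  then show "ellF y \<le> 1 - ln (1 - y) / pi" by simp
qed

text \<open>Comparing coefficients of x^n, the equation is \<open>ellc_rec\<close>, because (n +
  1/2)^2 - n (n + 1) = 1/4.\<close>

lemma ellF_ode:
  obtains F' F'' where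
    "\<And>x. \<bar>x\<bar> < 1 \<Longrightarrow> (ellF has_real_derivative F' x) (at x)"
    "\<And>x. \<bar>x\<bar> < 1 \<Longrightarrow> (F' has_real_derivative F'' x) (at x)"
    "\<And>x. \<bar>x\<bar> < 1 \<Longrightarrow> x * (1 - x) * F'' x + (1 - 2 * x) * F' x = ellF x / 4"
proof
  define F' where "F' = (\<lambda>x. \<Sum>n. diffs ellc n * x ^ n)"
  define F'' where "F'' = (\<lambda>x. \<Sum>n. diffs (diffs ellc) n * x ^ n)"
  have s0: "\<And>x. norm x < 1 \<Longrightarrow> summable (\<lambda>n. ellc n * x ^ n)"
    by (simp add: ellF_summable)
  have s1: "summable (\<lambda>n. diffs ellc n * x ^ n)" if "\<bar>x\<bar> < 1" for x
    by (rule termdiff_converges[OF _ s0]) (use that in auto)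
  have s2: "summable (\<lambda>n. diffs (diffs ellc) n * x ^ n)" if "\<bar>x\<bar> < 1" for x
    by (rule termdiff_converges[OF _ s1]) (use that in auto)
  show "(ellF has_real_derivative F' x) (at x)" if "\<bar>x\<bar> < 1" for x
    unfolding ellF_eq[abs_def] F'_def by (rule termdiffs_strong'[OF s0]) (use that in auto)
  show "(F' has_real_derivative F'' x) (at x)" if "\<bar>x\<bar> < 1" for x
    unfolding F'_def F''_def by (rule termdiffs_strong'[OF s1]) (use that in auto)
  show "x * (1 - x) * F'' x + (1 - 2 * x) * F' x = ellF x / 4" if x: "\<bar>x\<bar> < 1" for x
  proof -
    have F: "(\<lambda>n. ellc n * x ^ n) sums ellF x"
      unfolding ellF_eq by (rule summable_sums[OF ellF_summable[OF x]])
    have F1: "(\<lambda>n. diffs ellc n * x ^ n) sums F' x"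
      unfolding F'_def by (rule summable_sums[OF s1[OF x]])
    have F2: "(\<lambda>n. diffs (diffs ellc) n * x ^ n) sums F'' x"
      unfolding F''_def by (rule summable_sums[OF s2[OF x]])
    \<comment> \<open>\<open>diffs\<close> followed by multiplication by x is the Euler operator x
      d/dx, which scales the n-th coefficient by n.\<close>
    have shift: "(\<lambda>n. real n * a n * x ^ n) sums (x * s)" if "(\<lambda>n. diffs a n * x ^ n) sums s" for a s
    proof -
      have "(\<lambda>n. real (Suc n) * a (Suc n) * x ^ Suc n) sums (x * s)"
        using sums_mult[OF that, of x] by (simp add: diffs_def mult_ac)
      then show ?thesis by (subst (asm) sums_Suc_iff) simp
    qed
    have xF1: "(\<lambda>n. real n * ellc n * x ^ n) sums (x * F' x)"
      by (rule shift[OF F1])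
    have xF2: "(\<lambda>n. real n * diffs ellc n * x ^ n) sums (x * F'' x)"
      by (rule shift[OF F2])
    have "(\<lambda>n. (real n * (real n - 1)) * ellc n * x ^ n) sums (x * (x * F'' x))"
    proof -
      have "(\<lambda>n. real n * ((real n - 1) * ellc n) * x ^ n) sums (x * (x * F'' x))"
        by (rule shift) (use xF2 in \<open>simp add: diffs_def mult_ac\<close>)
      then show ?thesis by (simp add: mult_ac)
    qed
    from sums_diff[OF sums_add[OF xF2 F1] sums_add[OF this sums_mult[OF xF1, of 2]]]
    have "(\<lambda>n. ellc n / 4 * x ^ n) sums (x * F'' x + F' x - (x * (x * F'' x) + 2 * (x * F' x)))"
    proof (rule sums_cong[THEN iffD1, rotated])
      fix n
      have "(real n * (real n + 1) + (real n + 1)) * ellc (Suc n)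
          - (real n * (real n - 1) + 2 * real n) * ellc n = ellc n / 4"
        using ellc_rec[of n] by (simp add: algebra_simps power2_eq_square)
      then have "((real n * (real n + 1) + (real n + 1)) * ellc (Suc n)
          - (real n * (real n - 1) + 2 * real n) * ellc n) * x ^ n = ellc n / 4 * x ^ n"
        by simp
      then show "real n * diffs ellc n * x ^ n + diffs ellc n * x ^ n -
         (real n * (real n - 1) * ellc n * x ^ n + 2 * (real n * ellc n * x ^ n)) = ellc n / 4 * x ^ n"
        unfolding diffs_def by (simp add: algebra_simps)
    qed
    moreover have "(\<lambda>n. ellc n / 4 * x ^ n) sums (ellF x / 4)"
      using sums_divide[OF F, of 4] by simp
    ultimately show ?thesis
      using sums_unique2 by (fastforce simp: algebra_simps)
  qed
qed

lemma ellF_strict_mono: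
  assumes "0 \<le> x" "x < y" "y < 1"
  shows "ellF x < ellF y"
proof -
  have sx: "summable (\<lambda>n. ellc n * x ^ n)" and sy: "summable (\<lambda>n. ellc n * y ^ n)"
    using assms by (auto intro!: ellF_summable)
  have "0 < (\<Sum>n. ellc n * y ^ n - ellc n * x ^ n)"
  proof (rule suminf_pos2[of _ 1])
    show "summable (\<lambda>n. ellc n * y ^ n - ellc n * x ^ n)"
      by (rule summable_diff[OF sy sx])
    show "0 \<le> ellc n * y ^ n - ellc n * x ^ n" for n
      using assms ellc_pos[of n] by (simp add: power_mono)
    show "0 < ellc 1 * y ^ 1 - ellc 1 * x ^ 1"
      using assms ellc_pos[of 1] by simp
  qed
  then show ?thesis
    unfolding ellF_eq suminf_diff[OF sy sx, symmetric] by simp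
qed

lemma ellF_ge_1: "0 \<le> x \<Longrightarrow> x < 1 \<Longrightarrow> 1 \<le> ellF x"
  using ellF_strict_mono[of 0 x] by (cases "x = 0") auto

text \<open>
  Both sides, divided by \<open>1 + x\<close>, solve \<open>(x (1 - x\<^sup>2) G')' = x G\<close>; their Wronskian vanishes because
  \<open>x (1 - x\<^sup>2)\<close> does so at 0.
\<close>

lemma ellF_landen:
  assumes "0 \<le> x" "x < 1"
  shows "ellF (4 * x / (1 + x)\<^sup>2) = (1 + x) * ellF (x\<^sup>2)"
proof -
  obtain F' F'' where F:
    "\<And>x. \<bar>x\<bar> < 1 \<Longrightarrow> (ellF has_real_derivative F' x) (at x)"
    "\<And>x. \<bar>x\<bar> < 1 \<Longrightarrow> (F' has_real_derivative F'' x) (at x)"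
    "\<And>x. \<bar>x\<bar> < 1 \<Longrightarrow> x * (1 - x) * F'' x + (1 - 2 * x) * F' x = ellF x / 4"
    using ellF_ode by blast
  \<comment> \<open>The self-adjoint form of the hypergeometric equation: E' = F/4, so F''
    disappears from the later calculus.\<close>
  define E where "E = (\<lambda>y. y * (1 - y) * F' y)"
  have E: "(E has_real_derivative ellF y / 4) (at y)" if "\<bar>y\<bar> < 1" for y
    unfolding E_def using F(3)[OF that]
    by (auto intro!: derivative_eq_intros F(2)[OF that] simp: algebra_simps)
  define y where "y = (\<lambda>x::real. 4 * x / (1 + x)\<^sup>2)"
  define y' where "y' = (\<lambda>x::real. 4 * (1 - x) / (1 + x) ^ 3)"
  \<comment> \<open>As a nonzero square, 1 - y is positive for x in [0,1), which keeps the
    transformed argument below 1.\<close>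
  have y1: "1 - y x = ((1 - x) / (1 + x))\<^sup>2" if "0 \<le> x" for x
    using that by (simp add: y_def power_divide divide_simps) (simp add: power2_eq_square algebra_simps)
  have yr: "\<bar>y x\<bar> < 1" if "0 \<le> x" "x < 1" for x
  proof -
    have "0 < ((1 - x) / (1 + x))\<^sup>2" using that by simp
    then have "y x < 1" using y1[OF that(1)] by linarith
    moreover have "y x \<ge> 0" using that by (simp add: y_def)
    ultimately show ?thesis by simp
  qed
  have xr: "\<bar>x\<^sup>2\<bar> < 1" if "0 \<le> x" "x < 1" for x :: real
    using that by (simp add: power_less_one_iff)
  have y': "(y has_real_derivative y' x) (at x)" if "0 \<le> x" for x
    unfolding y_def y'_def using that
    by (auto intro!: derivative_eq_intros simp: divide_simps)
      (simp add: power2_eq_square power3_eq_cube power4_eq_xxxx algebra_simps)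
  define G where "G = (\<lambda>x. ellF (y x) / (1 + x))"
  define H where "H = (\<lambda>x. ellF (x\<^sup>2))"
  define G' where "G' = (\<lambda>x. F' (y x) * y' x / (1 + x) - ellF (y x) / (1 + x)\<^sup>2)"
  define H' where "H' = (\<lambda>x. F' (x\<^sup>2) * (2 * x))"
  have dG: "(G has_real_derivative G' x) (at x)" if "0 \<le> x" "x < 1" for x
  proof -
    have "1 + x \<noteq> 0" using that by simp
    then show ?thesis
      unfolding G_def G'_def using that
      by (auto intro!: derivative_eq_intros DERIV_chain2[OF F(1) y'] yr simp: diff_divide_distrib power2_eq_square)
  qed
  have dH: "(H has_real_derivative H' x) (at x)" if "0 \<le> x" "x < 1" for x
    unfolding H_def H'_def using that
    by (auto intro!: derivative_eq_intros DERIV_chain2[OF F(1)] xr)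
  \<comment> \<open>These are x (1 - x^2) G' and x (1 - x^2) H', as shown below; they are written
    with E so that differentiating them does not bring in F''.\<close>
  define PG where "PG = (\<lambda>x. (1 + x) * E (y x) - x * (1 - x) / (1 + x) * ellF (y x))"
  define PH where "PH = (\<lambda>x. 2 * E (x\<^sup>2))"
  \<comment> \<open>The differential equation of the substitution y; it turns x (1 - x) y' F'(y)
    into (1 + x) E(y).\<close>
  have key: "x * (1 - x) * y' x = (1 + x) * (y x * (1 - y x))" if "0 \<le> x" for x
    unfolding y1[OF that] using that by (simp add: y_def y'_def divide_simps) (simp add: power2_eq_square power3_eq_cube power4_eq_xxxx algebra_simps)
  have PG: "PG x = x * (1 - x\<^sup>2) * G' x" if "0 \<le> x" for x
  proof -
    have "x * (1 - x\<^sup>2) * G' x = (x * (1 - x) * y' x) * F' (y x) - x * (1 - x) / (1 + x) * ellF (y x)"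
      using that unfolding G'_def by (simp add: divide_simps) (simp add: power2_eq_square algebra_simps)
    then show ?thesis
      unfolding key[OF that] by (simp add: PG_def E_def algebra_simps)
  qed
  have PH: "PH x = x * (1 - x\<^sup>2) * H' x" for x
    unfolding PH_def H'_def E_def by (simp add: power2_eq_square algebra_simps)
  have dPG: "(PG has_real_derivative x * G x) (at x)" if "0 \<le> x" "x < 1" for x
  proof -
    have D: "(PG has_real_derivative E (y x) + (1 + x) * (ellF (y x) / 4 * y' x)
       - ((1 - 2 * x - x\<^sup>2) / (1 + x)\<^sup>2 * ellF (y x) + x * (1 - x) / (1 + x) * (F' (y x) * y' x))) (at x)"
    proof -
      have "((\<lambda>x. x * (1 - x) / (1 + x)) has_real_derivative (1 - 2 * x - x\<^sup>2) / (1 + x)\<^sup>2) (at x)"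
        using that by (auto intro!: derivative_eq_intros simp: power2_eq_square algebra_simps)
      from DERIV_diff[OF DERIV_mult[OF DERIV_add[OF DERIV_const DERIV_ident] DERIV_chain2[OF E y'[OF that(1)]]]
          DERIV_mult[OF this DERIV_chain2[OF F(1) y'[OF that(1)]]], OF yr[OF that] yr[OF that], of 1]
      show ?thesis
        unfolding PG_def by (rule DERIV_cong) (simp add: mult_ac)
    qed
    have e1: "x * (1 - x) / (1 + x) * (F' (y x) * y' x) = E (y x)"
    proof -
      have "x * (1 - x) / (1 + x) * (F' (y x) * y' x) = (x * (1 - x) * y' x) * F' (y x) / (1 + x)"
        by (simp add: mult_ac)
      also have "\<dots> = E (y x)"
        unfolding key[OF that(1)] E_def using that by simp
      finally show ?thesis .
    qed
    have e2: "(1 + x) * (ellF (y x) / 4 * y' x) - (1 - 2 * x - x\<^sup>2) / (1 + x)\<^sup>2 * ellF (y x) = x * G x"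
      using that unfolding G_def y'_def by (simp add: divide_simps) (simp add: power2_eq_square power3_eq_cube algebra_simps)
    show ?thesis by (rule DERIV_cong[OF D]) (use e1 e2 in linarith)
  qed
  have dPH: "(PH has_real_derivative x * H x) (at x)" if "0 \<le> x" "x < 1" for x
    unfolding PH_def H_def using that
    by (auto intro!: derivative_eq_intros DERIV_chain2[OF E] xr)
  have H1: "H x \<ge> 1" if "0 \<le> x" "x < 1" for x
    unfolding H_def using xr[OF that] by (intro ellF_ge_1) auto
  \<comment> \<open>In the derivative the terms x G H cancel, and H' \<open>PG\<close> = G'
    \<open>PH\<close> because both carry the factor x (1 - x^2).\<close>
  have W: "PG x * H x - G x * PH x = 0" if "0 \<le> x" "x < 1" for x
  proof -
    have "\<exists>c. \<forall>x\<in>{0..<1}. PG x * H x - G x * PH x = c"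
    proof (rule has_field_derivative_zero_constant)
      fix x :: real assume x: "x \<in> {0..<1}"
      have "((\<lambda>x. PG x * H x - G x * PH x) has_real_derivative
          x * G x * H x + H' x * PG x - (G' x * PH x + x * H x * G x)) (at x)"
        using x by (auto intro!: derivative_eq_intros dPG dH dG dPH)
      moreover have "x * G x * H x + H' x * PG x - (G' x * PH x + x * H x * G x) = 0"
        using x by (simp add: PG PH algebra_simps)
      ultimately show "((\<lambda>x. PG x * H x - G x * PH x) has_real_derivative 0) (at x within {0..<1})"
        by (metis has_field_derivative_at_within)
    qed (simp add: convex_real_interval)
    then obtain c where c: "\<And>x. x \<in> {0..<1} \<Longrightarrow> PG x * H x - G x * PH x = c" by blast
    from c[of 0] have "c = 0" by (simp add: PG PH)
    with c[of x] that show ?thesis by simp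
  qed
  \<comment> \<open>For z > 0 the factor z (1 - z^2) can be divided out of the Wronskian, so G/H has
    zero derivative; continuity carries the value down to 0.\<close>
  have "G x / H x = G 0 / H 0"
  proof (cases "x = 0")
    case False
    show ?thesis
    proof (rule DERIV_isconst_end[where f = "\<lambda>x. G x / H x"])
      show "0 < x" using False assms by simp
      have d: "((\<lambda>x. G x / H x) has_real_derivative (G' z * H z - G z * H' z) / (H z * H z)) (at z)"
        if "0 \<le> z" "z < 1" for z
        using that H1[OF that] by (auto intro!: derivative_eq_intros dG dH)
      show "continuous_on {0..x} (\<lambda>x. G x / H x)"
        using assms by (intro continuous_at_imp_continuous_on ballI DERIV_isCont[OF d]) auto
      fix z assume z: "0 < z" "z < x"
      have "z * (1 - z\<^sup>2) * (G' z * H z - G z * H' z) = 0"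
        using W[of z] z assms by (simp add: PG PH algebra_simps)
      moreover have "z * (1 - z\<^sup>2) \<noteq> 0"
        using xr[of z] z assms by auto
      ultimately have "G' z * H z - G z * H' z = 0" by simp
      then show "((\<lambda>x. G x / H x) has_real_derivative 0) (at z)"
        using d[of z] z assms by simp
    qed
  qed simp
  moreover have "G 0 / H 0 = 1" by (simp add: G_def H_def y_def)
  ultimately have "G x = H x"
    using H1[of x] assms by simp
  then have "ellF (y x) = (1 + x) * H x"
    using assms by (simp add: G_def divide_eq_eq mult.commute)
  then show ?thesis by (simp add: H_def y_def)
qed

section \<open>Product formulas for theta functions\<close>

text \<open>Jacobi's theta functions at the argument pi u: h = 0 gives theta_3 and h = 1/2 gives
  theta_2.\<close>

definition jtheta :: "real \<Rightarrow> real \<Rightarrow> real \<Rightarrow> real" where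
  "jtheta h q u = (\<Sum>\<^sub>\<infinity>k::int. q powr ((real_of_int k + h)\<^sup>2) * cos (2 * pi * (real_of_int k + h) * u))"

section \<open>Absolutely convergent sums over shifted integers\<close>

lemma has_sum_int:
  fixes f :: "int \<Rightarrow> 'a :: topological_comm_monoid_add"
  assumes "((\<lambda>n. f (int n)) has_sum a) UNIV" "((\<lambda>n. f (- int (Suc n))) has_sum b) UNIV"
  shows "(f has_sum (a + b)) UNIV"
proof -
  have "(f has_sum a) (range int)"
    using assms(1) by (subst has_sum_reindex) (auto simp: o_def)
  moreover have "(f has_sum b) (range (\<lambda>n. - int (Suc n)))"
    using assms(2) by (subst has_sum_reindex) (auto simp: o_def inj_on_def)
  moreover have "range int \<inter> range (\<lambda>n. - int (Suc n)) = {}"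
    by auto
  moreover have "range int \<union> range (\<lambda>n. - int (Suc n)) = UNIV"
  proof -
    have "k \<in> range int \<union> range (\<lambda>n. - int (Suc n))" for k
    proof (cases "k \<ge> 0")
      case True
      then have "k = int (nat k)" by simp
      then show ?thesis by blast
    next
      case False
      then have "k = - int (Suc (nat (- k - 1)))" by simp
      then show ?thesis by blast
    qed
    then show ?thesis by blast
  qed
  ultimately show ?thesis using has_sum_Un_disjoint by metis
qed

lemma geometric_has_sum:
  fixes q :: real
  assumes "0 < q" "q < 1"
  shows "((\<lambda>n. q ^ n) has_sum (1 / (1 - q))) UNIV"
  using assms geometric_sums[of q] by (intro sums_nonneg_imp_has_sum) auto

lemma geometric_int_has_sum:
  fixes q :: real
  assumes "0 < q" "q < 1"
  shows "((\<lambda>k::int. q ^ nat \<bar>k\<bar>) has_sum (1 / (1 - q) + q / (1 - q))) UNIV"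
proof (rule has_sum_int)
  show "((\<lambda>n. q ^ nat \<bar>int n\<bar>) has_sum (1 / (1 - q))) UNIV"
    using geometric_has_sum[OF assms] by simp
  show "((\<lambda>n. q ^ nat \<bar>- int (Suc n)\<bar>) has_sum (q / (1 - q))) UNIV"
    using has_sum_cmult_right[OF geometric_has_sum[OF assms], of q] by (simp add: nat_add_distrib)
qed

text \<open>From (|x| - 1/2)^2 >= 0 one gets x^2 >= |x| - 1/4, so at x = k + h the Gaussian terms
  are dominated by a geometric series in |k|.\<close>

lemma gauss_summable:
  assumes "0 < q" "q < 1"
  shows "(\<lambda>k::int. q powr ((real_of_int k + h)\<^sup>2)) summable_on UNIV"
proof (rule summable_on_comparison_test)
  let ?C = "q powr (- (\<bar>h\<bar> + 1/4))"
  show "(\<lambda>k::int. ?C * q ^ nat \<bar>k\<bar>) summable_on UNIV"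
    using has_sum_cmult_right[OF geometric_int_has_sum[OF assms]] by (auto simp: summable_on_def)
  fix k :: int
  have "(\<bar>real_of_int k + h\<bar> - 1/2)\<^sup>2 \<ge> 0" by simp
  then have "(real_of_int k + h)\<^sup>2 \<ge> \<bar>real_of_int k + h\<bar> - 1/4"
    unfolding power2_diff power2_abs by (simp add: power2_eq_square)
  then have "(real_of_int k + h)\<^sup>2 \<ge> - (\<bar>h\<bar> + 1/4) + real (nat \<bar>k\<bar>)"
    by simp
  then have "q powr ((real_of_int k + h)\<^sup>2) \<le> q powr (- (\<bar>h\<bar> + 1/4) + real (nat \<bar>k\<bar>))"
    using assms by (intro powr_mono') auto
  also have "\<dots> = ?C * q ^ nat \<bar>k\<bar>"
    using assms by (simp only: powr_add powr_realpow)
  finally show "q powr ((real_of_int k + h)\<^sup>2) \<le> ?C * q ^ nat \<bar>k\<bar>" .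
qed simp

lemma gauss_summable_bounded:
  fixes f :: "int \<Rightarrow> 'a :: {real_normed_algebra_1,banach}"
  assumes "0 < q" "q < 1" "\<And>k. norm (f k) \<le> 1"
  shows "(\<lambda>k::int. norm (of_real (q powr ((real_of_int k + h)\<^sup>2)) * f k)) summable_on UNIV"
proof (rule Infinite_Sum.abs_summable_on_comparison_test'[OF gauss_summable[OF assms(1,2), of h]])
  fix k :: int
  have "norm (of_real (q powr ((real_of_int k + h)\<^sup>2)) * f k) \<le> q powr ((real_of_int k + h)\<^sup>2) * norm (f k)"
    by (rule order_trans[OF norm_mult_ineq]) simp
  also have "\<dots> \<le> q powr ((real_of_int k + h)\<^sup>2) * 1"
    by (intro mult_left_mono assms) simp
  finally show "norm (of_real (q powr ((real_of_int k + h)\<^sup>2)) * f k) \<le> q powr ((real_of_int k + h)\<^sup>2)"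
    by simp
qed

lemma jtheta_has_sum:
  assumes "0 < q" "q < 1"
  shows "((\<lambda>k::int. q powr ((real_of_int k + h)\<^sup>2) * cos (2 * pi * (real_of_int k + h) * u))
           has_sum jtheta h q u) UNIV"
  using abs_summable_summable[OF gauss_summable_bounded[OF assms, of "\<lambda>k. cos (2 * pi * (real_of_int k + h) * u)" h]]
  unfolding jtheta_def by (intro has_sum_infsum) simp

text \<open>A theta term indexed by the real point x instead of an integer, so that a rotation of
  the lattice is a substitution on pairs of reals; the exponential replaces the cosine to make terms
  multiply.\<close>

definition gwave :: "real \<Rightarrow> real \<Rightarrow> real \<Rightarrow> complex" where
  "gwave q u x = of_real (q powr (x\<^sup>2)) * cis (2 * pi * x * u)"

definition coset :: "real \<Rightarrow> real set" where
  "coset h = range (\<lambda>k::int. real_of_int k + h)"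

text \<open>The imaginary part cancels under x -> -x. This reflection preserves the shifted integers
  just for shifts such as 0 and 1/2, the two allowed here.\<close>

lemma gwave_has_sum_int:
  assumes q: "0 < q" "q < 1" and h: "h = 0 \<or> h = 1/2"
  shows "((\<lambda>k::int. gwave q u (real_of_int k + h)) has_sum of_real (jtheta h q u)) UNIV"
proof -
  let ?s = "\<lambda>k::int. q powr ((real_of_int k + h)\<^sup>2) * sin (2 * pi * (real_of_int k + h) * u)"
  have "?s summable_on UNIV"
    using abs_summable_summable[OF gauss_summable_bounded[OF q, of "\<lambda>k. sin (2 * pi * (real_of_int k + h) * u)" h]]
    by simp
  then obtain S where S: "(?s has_sum S) UNIV" by (auto simp: summable_on_def)
  \<comment> \<open>The reflection k + h -> -(k + h), expressed on the integer index.\<close>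
  define r where "r = (\<lambda>k::int. if h = 0 then - k else - k - 1)"
  have "((\<lambda>k. - ?s k) has_sum S) UNIV \<longleftrightarrow> (?s has_sum S) UNIV"
  proof (rule has_sum_reindex_bij_witness[where i = r and j = r])
    show "r (r k) = k" for k by (simp add: r_def)
    show "r (r k) = k" for k by (simp add: r_def)
    fix k
    have r: "real_of_int (r k) + h = - (real_of_int k + h)" using h by (auto simp: r_def)
    show "?s (r k) = - ?s k"
      unfolding r by (simp only: power2_minus mult_minus_right mult_minus_left sin_minus)
  qed auto
  with S have "((\<lambda>k. - ?s k) has_sum S) UNIV" by simp
  then have "(?s has_sum - S) UNIV" by (simp add: has_sum_uminus)
  with S have "S = - S" using has_sum_unique by blast
  then have S0: "S = 0" by simp
  have "((\<lambda>k. of_real (q powr ((real_of_int k + h)\<^sup>2) * cos (2 * pi * (real_of_int k + h) * u)) + \<i> * of_real (?s k))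
     has_sum (of_real (jtheta h q u) + \<i> * of_real S)) UNIV"
    by (intro has_sum_add has_sum_cmult_right has_sum_of_real jtheta_has_sum[OF q] S)
  moreover have "of_real (q powr ((real_of_int k + h)\<^sup>2) * cos (2 * pi * (real_of_int k + h) * u)) + \<i> * of_real (?s k)
      = gwave q u (real_of_int k + h)" for k
    by (simp add: gwave_def complex_eq_iff)
  ultimately show ?thesis by (simp add: S0)
qed

lemma gwave_has_sum:
  assumes "0 < q" "q < 1" "h = 0 \<or> h = 1/2"
  shows "(gwave q u has_sum of_real (jtheta h q u)) (coset h)"
  unfolding coset_def using gwave_has_sum_int[OF assms]
  by (subst has_sum_reindex) (auto simp: inj_on_def o_def)

lemma gwave_abs_summable:
  assumes "0 < q" "q < 1"
  shows "(\<lambda>x. norm (gwave q u x)) summable_on coset h"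
proof -
  have "inj_on (\<lambda>k::int. real_of_int k + h) UNIV" by (auto simp: inj_on_def)
  then show ?thesis
    unfolding coset_def using gauss_summable[OF assms, of h]
    by (subst summable_on_reindex) (auto simp: gwave_def o_def norm_mult)
qed

lemma has_sum_times:
  fixes f :: "'a \<Rightarrow> complex" and g :: "'b \<Rightarrow> complex"
  assumes f: "(f has_sum a) A" "(\<lambda>x. norm (f x)) summable_on A" and g: "(g has_sum b) B" "(\<lambda>x. norm (g x)) summable_on B"
  shows "((\<lambda>(x, y). f x * g y) has_sum (a * b)) (A \<times> B)"
proof (rule has_sum_SigmaI)
  show "((\<lambda>y. case (x, y) of (x, y) \<Rightarrow> f x * g y) has_sum f x * b) B" if "x \<in> A" for x
    using has_sum_cmult_right[OF g(1), of "f x"] by simp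
  show "((\<lambda>x. f x * b) has_sum a * b) A"
    by (rule has_sum_cmult_left[OF f(1)])
  have "(\<lambda>z. norm (case z of (x, y) \<Rightarrow> f x * g y)) summable_on A \<times> B"
    unfolding Infinite_Sum.abs_summable_on_Sigma_iff
  proof (intro conjI ballI)
    show "(\<lambda>y. norm (case (x, y) of (x, y) \<Rightarrow> f x * g y)) summable_on B" if "x \<in> A" for x
      using summable_on_cmult_right[OF g(2), of "norm (f x)"] by (simp add: norm_mult)
    show "(\<lambda>x. norm (\<Sum>\<^sub>\<infinity>y\<in>B. norm (case (x, y) of (x, y) \<Rightarrow> f x * g y))) summable_on A"
      using summable_on_cmult_left[OF f(2), of "infsum (\<lambda>y. norm (g y)) B"] 
      by (simp add: norm_mult infsum_cmult_right' abs_mult infsum_nonneg)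
  qed
  then show "(\<lambda>(x, y). f x * g y) summable_on A \<times> B"
    by (rule abs_summable_summable)
qed

text \<open>The parallelogram law (a + b)^2 + (a - b)^2 = 2 a^2 + 2 b^2 is what squares the
  nome.\<close>

lemma gwave_mult:
  assumes "0 < q"
  shows "gwave q u (a + b) * gwave q v (a - b) = gwave (q\<^sup>2) (u + v) a * gwave (q\<^sup>2) (u - v) b"
proof -
  have "q powr ((a + b)\<^sup>2) * q powr ((a - b)\<^sup>2) = (q\<^sup>2) powr (a\<^sup>2) * (q\<^sup>2) powr (b\<^sup>2)"
  proof -
    have "(q\<^sup>2) powr x = q powr (2 * x)" for x
      using assms by (simp add: powr_powr[symmetric])
    then show ?thesis
      by (simp add: powr_add[symmetric] power2_eq_square algebra_simps)
  qed
  moreover have "cis (2 * pi * (a + b) * u) * cis (2 * pi * (a - b) * v) =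
      cis (2 * pi * a * (u + v)) * cis (2 * pi * b * (u - v))"
    by (simp add: cis_mult algebra_simps)
  ultimately show ?thesis
    by (simp add: gwave_def mult_ac) (metis mult.assoc of_real_mult)
qed

text \<open>Both product formulas come from rotating the index lattice by \<open>(a, b) \<mapsto> (a + b, a - b)\<close>.\<close>

lemma jtheta_product:
  assumes q: "0 < q" "q < 1"
    and h: "h = 0 \<or> h = 1/2" "h1 = 0 \<or> h1 = 1/2" "h2 = 0 \<or> h2 = 1/2" "h3 = 0 \<or> h3 = 1/2" "h4 = 0 \<or> h4 = 1/2" 
    and sets: "coset h \<times> coset h = (\<lambda>(a, b). (a + b, a - b)) ` (coset h1 \<times> coset h2 \<union> coset h3 \<times> coset h4)"
    and disj: "(coset h1 \<times> coset h2) \<inter> (coset h3 \<times> coset h4) = {}"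
  shows "jtheta h q u * jtheta h q v =
    jtheta h1 (q\<^sup>2) (u + v) * jtheta h2 (q\<^sup>2) (u - v) + jtheta h3 (q\<^sup>2) (u + v) * jtheta h4 (q\<^sup>2) (u - v)"
proof -
  have Q: "0 < q\<^sup>2" "q\<^sup>2 < 1" using q by (auto simp: power_less_one_iff)
  let ?r = "\<lambda>(a, b). (a + b, a - b) :: real \<times> real"
  let ?f = "\<lambda>(x, y). gwave q u x * gwave q v y" and ?g = "\<lambda>(x, y). gwave (q\<^sup>2) (u + v) x * gwave (q\<^sup>2) (u - v) y"
  have "(?f has_sum (of_real (jtheta h q u) * of_real (jtheta h q v))) (coset h \<times> coset h)"
    by (intro has_sum_times gwave_has_sum gwave_abs_summable q h)
  then have "((?f \<circ> ?r) has_sum (of_real (jtheta h q u) * of_real (jtheta h q v))) (coset h1 \<times> coset h2 \<union> coset h3 \<times> coset h4)"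
    unfolding sets by (subst (asm) has_sum_reindex) (auto simp: inj_on_def)
  moreover have "?f \<circ> ?r = ?g"
    using gwave_mult[OF q(1)] by (auto simp: fun_eq_iff)
  moreover have "(?g has_sum (of_real (jtheta h1 (q\<^sup>2) (u + v)) * of_real (jtheta h2 (q\<^sup>2) (u - v))
     + of_real (jtheta h3 (q\<^sup>2) (u + v)) * of_real (jtheta h4 (q\<^sup>2) (u - v)))) (coset h1 \<times> coset h2 \<union> coset h3 \<times> coset h4)"
    by (intro has_sum_Un_disjoint has_sum_times gwave_has_sum gwave_abs_summable Q h disj)
  ultimately have "complex_of_real (jtheta h q u * jtheta h q v) =
    of_real (jtheta h1 (q\<^sup>2) (u + v) * jtheta h2 (q\<^sup>2) (u - v) + jtheta h3 (q\<^sup>2) (u + v) * jtheta h4 (q\<^sup>2) (u - v))"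
    using has_sum_unique by (fastforce simp del: of_real_eq_iff)
  then show ?thesis by (simp only: of_real_eq_iff)
qed

lemma coset_disjoint: "coset 0 \<inter> coset (1/2) = {}"
proof -
  have False if "real_of_int k = real_of_int l + 1/2" for k l
  proof -
    have "real_of_int (2 * k) = real_of_int (2 * l + 1)" using that by simp
    then have "2 * k = 2 * l + 1" by (simp only: of_int_eq_iff)
    then show False by presburger
  qed
  then show ?thesis by (auto simp: coset_def)
qed

lemma cosetI: "x = real_of_int k + h \<Longrightarrow> x \<in> coset h"
  by (auto simp: coset_def)

lemma coset_add: "x \<in> coset a \<Longrightarrow> y \<in> coset b \<Longrightarrow> x + y \<in> coset (a + b)"
  unfolding coset_def by clarify (rule range_eqI[of _ _ "_ + _"], simp)

lemma coset_diff: "x \<in> coset a \<Longrightarrow> y \<in> coset b \<Longrightarrow> x - y \<in> coset (a - b)"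
  unfolding coset_def by clarify (rule range_eqI[of _ _ "_ - _"], simp)

lemma coset_plus_1: "coset (h + 1) = coset h"
proof -
  have "real_of_int k + (h + 1) \<in> coset h" for k
    by (rule cosetI[of _ "k + 1"]) simp
  moreover have "real_of_int k + h \<in> coset (h + 1)" for k
    by (rule cosetI[of _ "k - 1"]) simp
  ultimately show ?thesis by (auto simp: coset_def)
qed

lemma coset_1: "coset 1 = coset 0"
  using coset_plus_1[of 0] by simp

lemma coset_minus_half: "coset (- (1/2)) = coset (1/2)"
  using coset_plus_1[of "- (1/2)"] by simp

text \<open>For integers x and y, the numbers (x + y)/2 and (x - y)/2 are both integers or both
  half-integers, according to the parity of x + y; each case contributes one term.\<close>

lemma jtheta_mult_0:
  assumes "0 < q" "q < 1"
  shows "jtheta 0 q u * jtheta 0 q v =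
    jtheta 0 (q\<^sup>2) (u + v) * jtheta 0 (q\<^sup>2) (u - v) + jtheta (1/2) (q\<^sup>2) (u + v) * jtheta (1/2) (q\<^sup>2) (u - v)"
proof (rule jtheta_product[OF assms])
  show "coset 0 \<times> coset 0 = (\<lambda>(a, b). (a + b, a - b)) ` (coset 0 \<times> coset 0 \<union> coset (1/2) \<times> coset (1/2))" (is "?L = ?R")
  proof
    show "?L \<subseteq> ?R"
    proof clarify
      fix x y assume "x \<in> coset 0" "y \<in> coset 0"
      then obtain k l where kl: "x = real_of_int k" "y = real_of_int l" by (auto simp: coset_def)
      let ?a = "(x + y) / 2" and ?b = "(x - y) / 2"
      have "(?a, ?b) \<in> coset 0 \<times> coset 0 \<union> coset (1/2) \<times> coset (1/2)"
      proof (cases "even (k + l)")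
        case True
        then obtain m where m: "k + l = 2 * m" by (rule evenE)
        then have "k = 2 * m - l" by simp
        then have "?a = real_of_int m + 0" "?b = real_of_int (m - l) + 0" using kl by simp_all
        then show ?thesis by (blast intro: cosetI)
      next
        case False
        then obtain m where m: "k + l = 2 * m + 1" by (rule oddE)
        then have "k = 2 * m + 1 - l" by simp
        then have "?a = real_of_int m + 1/2" "?b = real_of_int (m - l) + 1/2" using kl by (simp_all add: field_simps)
        then show ?thesis by (blast intro: cosetI)
      qed
      moreover have "(x, y) = (?a + ?b, ?a - ?b)" by (simp add: field_simps)
      ultimately show "(x, y) \<in> ?R" by (metis (mono_tags, lifting) case_prod_conv image_eqI)
    qed
    show "?R \<subseteq> ?L"
      using coset_add[of _ 0 _ 0] coset_diff[of _ 0 _ 0] coset_add[of _ "1/2" _ "1/2"] coset_diff[of _ "1/2" _ "1/2"]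
      by (auto simp: coset_1)
  qed
qed (use coset_disjoint in auto)

text \<open>For half-integers x and y, exactly one of (x + y)/2 and (x - y)/2 is an integer, whence
  the mixed products.\<close>

lemma jtheta_mult_half:
  assumes "0 < q" "q < 1"
  shows "jtheta (1/2) q u * jtheta (1/2) q v =
    jtheta 0 (q\<^sup>2) (u + v) * jtheta (1/2) (q\<^sup>2) (u - v) + jtheta (1/2) (q\<^sup>2) (u + v) * jtheta 0 (q\<^sup>2) (u - v)"
proof (rule jtheta_product[OF assms])
  show "coset (1/2) \<times> coset (1/2) = (\<lambda>(a, b). (a + b, a - b)) ` (coset 0 \<times> coset (1/2) \<union> coset (1/2) \<times> coset 0)" (is "?L = ?R")
  proof
    show "?L \<subseteq> ?R"
    proof clarify
      fix x y assume "x \<in> coset (1/2)" "y \<in> coset (1/2)"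
      then obtain k l where kl: "x = real_of_int k + 1/2" "y = real_of_int l + 1/2" by (auto simp: coset_def)
      let ?a = "(x + y) / 2" and ?b = "(x - y) / 2"
      have "(?a, ?b) \<in> coset 0 \<times> coset (1/2) \<union> coset (1/2) \<times> coset 0"
      proof (cases "even (k + l)")
        case True
        then obtain m where m: "k + l = 2 * m" by (rule evenE)
        then have "k = 2 * m - l" by simp
        then have "?a = real_of_int m + 1/2" "?b = real_of_int (m - l) + 0" using kl by (simp_all add: field_simps)
        then show ?thesis by (blast intro: cosetI)
      next
        case False
        then obtain m where m: "k + l = 2 * m + 1" by (rule oddE)
        then have "k = 2 * m + 1 - l" by simp
        then have "?a = real_of_int (m + 1) + 0" "?b = real_of_int (m - l) + 1/2" using kl by (simp_all add: field_simps)
        then show ?thesis by (blast intro: cosetI)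
      qed
      moreover have "(x, y) = (?a + ?b, ?a - ?b)" by (simp add: field_simps)
      ultimately show "(x, y) \<in> ?R" by (metis (mono_tags, lifting) case_prod_conv image_eqI)
    qed
    show "?R \<subseteq> ?L"
      using coset_add[of _ 0 _ "1/2"] coset_diff[of _ 0 _ "1/2"] coset_add[of _ "1/2" _ 0] coset_diff[of _ "1/2" _ 0]
      by (auto simp: coset_minus_half)
  qed
qed (use coset_disjoint in auto)

section \<open>Symmetries in u, and the theta-nulls as special values\<close>

lemma jtheta_0_plus_1: "jtheta 0 q (u + 1) = jtheta 0 q u"
proof -
  have "cos (2 * pi * real_of_int k * (u + 1)) = cos (2 * pi * real_of_int k * u)" for k
    using cos_int_2pin[of k] sin_int_2pin[of k] by (simp add: distrib_left cos_add mult_ac)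
  then show ?thesis by (simp add: jtheta_def)
qed

lemma jtheta_half_plus_1: "jtheta (1/2) q (u + 1) = - jtheta (1/2) q u"
proof -
  have "cos (2 * pi * (real_of_int k + 1/2) * (u + 1)) = - cos (2 * pi * (real_of_int k + 1/2) * u)" for k
  proof -
    have "2 * pi * (real_of_int k + 1/2) * (u + 1) = 2 * pi * (real_of_int k + 1/2) * u + 2 * pi * real_of_int k + pi"
      by (simp add: algebra_simps)
    then show ?thesis
      using cos_int_2pin[of k] sin_int_2pin[of k] by (simp add: cos_add)
  qed
  then show ?thesis by (simp add: jtheta_def infsum_uminus)
qed

lemma jtheta_minus: "jtheta h q (- u) = jtheta h q u"
  by (simp add: jtheta_def)

text \<open>An even function that changes sign under u -> u + 1 vanishes at 1/2.\<close>

lemma jtheta_half_half: "jtheta (1/2) q (1/2) = 0" "jtheta (1/2) q (- (1/2)) = 0"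
  using jtheta_half_plus_1[of q "- (1/2)"] jtheta_minus[of "1/2" q "1/2"] by auto

lemma theta3_jtheta: "theta3 q = jtheta 0 q 0"
  by (simp add: theta3_def jtheta_def)

lemma theta2_jtheta: "theta2 q = jtheta (1/2) q 0"
  by (simp add: theta2_def jtheta_def)

lemma cos_int_pi: "cos (pi * real_of_int k) = (- 1) ^ nat \<bar>k\<bar>"
proof -
  have "cos (pi * real_of_int k) = cos (pi * \<bar>real_of_int k\<bar>)"
    by (cases "k \<ge> 0") auto
  also have "\<bar>real_of_int k\<bar> = real (nat \<bar>k\<bar>)" by simp
  finally show ?thesis by (simp only: cos_npi2)
qed

lemma theta4_jtheta: "theta4 q = jtheta 0 q (1/2)"
proof -
  have "cos (2 * pi * real_of_int k * (1/2)) = (- 1) ^ nat \<bar>k\<bar>" for k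
    using cos_int_pi[of k] by simp
  then show ?thesis by (simp add: theta4_def jtheta_def mult.commute)
qed

text \<open>Shifting u by 1/2 multiplies the k-th term by (-1)^k: odd terms cancel, even ones
  double, and the index 2k replaces q by q^4.\<close>

lemma jtheta_0_shift_sum:
  assumes q: "0 < q" "q < 1"
  shows "jtheta 0 q u + jtheta 0 q (u + 1/2) = 2 * jtheta 0 (q ^ 4) (2 * u)"
proof -
  have Q: "0 < q ^ 4" "q ^ 4 < 1" using q by (auto simp: power_less_one_iff)
  let ?t = "\<lambda>u k. q powr ((real_of_int k)\<^sup>2) * cos (2 * pi * real_of_int k * u)"
  let ?f = "\<lambda>k. ?t u k + ?t (u + 1/2) k"
  have "(?f has_sum (jtheta 0 q u + jtheta 0 q (u + 1/2))) UNIV"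
    using jtheta_has_sum[OF q, of 0] by (intro has_sum_add) simp_all
  moreover have "(?f has_sum 2 * jtheta 0 (q ^ 4) (2 * u)) (range (\<lambda>k. 2 * k))"
  proof (subst has_sum_reindex)
    have "?f (2 * k) = 2 * ((q ^ 4) powr ((real_of_int k)\<^sup>2) * cos (2 * pi * real_of_int k * (2 * u)))" for k
    proof -
      have "(q ^ 4) powr ((real_of_int k)\<^sup>2) = q powr ((real_of_int (2 * k))\<^sup>2)"
        using q by (simp add: powr_powr[symmetric] power_mult_distrib)
      moreover have "cos (2 * pi * real_of_int (2 * k) * (u + 1/2)) = cos (2 * pi * real_of_int k * (2 * u))"
        using cos_int_2pin[of k] sin_int_2pin[of k] by (simp add: distrib_left cos_add mult_ac)
      ultimately show ?thesis by (simp add: mult_ac)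
    qed
    then have "?f \<circ> (*) 2 = (\<lambda>k. 2 * ((q ^ 4) powr ((real_of_int k)\<^sup>2) * cos (2 * pi * real_of_int k * (2 * u))))"
      by (simp add: fun_eq_iff)
    then show "(?f \<circ> (*) 2 has_sum 2 * jtheta 0 (q ^ 4) (2 * u)) UNIV"
      using has_sum_cmult_right[OF jtheta_has_sum[OF Q, of 0 "2 * u"], of 2] by simp
  qed (auto simp: inj_on_def)
  moreover have "?f k = 0" if "k \<notin> range (\<lambda>k. 2 * k)" for k
  proof -
    have "odd k" using that by (auto elim!: evenE)
    then obtain m where m: "k = 2 * m + 1" by (rule oddE)
    have "2 * pi * real_of_int k * (u + 1/2) = 2 * pi * real_of_int k * u + 2 * pi * real_of_int m + pi"
      by (simp add: m algebra_simps)
    then have "cos (2 * pi * real_of_int k * (u + 1/2)) = - cos (2 * pi * real_of_int k * u)"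
      using cos_int_2pin[of m] sin_int_2pin[of m] by (simp add: cos_add)
    then show ?thesis by simp
  qed
  ultimately show ?thesis
    using has_sum_unique has_sum_cong_neutral[of UNIV "range (\<lambda>k. 2 * k)" ?f ?f] 
    by (metis (no_types, lifting) DiffE DiffD2 UNIV_I)
qed

text \<open>After removal of the term k = 0, compare with a geometric series through k^2 >= |k|. The
  bound is uniform in u, so it can start the descents in \<open>jtheta_0_pos\<close> and
  \<open>jtheta_0_min\<close>.\<close>

lemma jtheta_0_near_1:
  assumes q: "0 < q" "q < 1"
  shows "\<bar>jtheta 0 q u - 1\<bar> \<le> 2 * q / (1 - q)"
proof -
  let ?d = "\<lambda>k::int. if k = 0 then 1 else 0 :: real"
  let ?t = "\<lambda>k. q powr ((real_of_int k)\<^sup>2) * cos (2 * pi * real_of_int k * u)"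
  have d: "(?d has_sum 1) UNIV"
    by (rule has_sum_finite_neutralI[of "{0}"]) auto
  have T: "((\<lambda>k. ?t k + - ?d k) has_sum (jtheta 0 q u + - 1)) UNIV"
    using jtheta_has_sum[OF q, of 0 u] by (intro has_sum_add has_sum_uminusI d) simp_all
  have G: "((\<lambda>k. q ^ nat \<bar>k\<bar> + - ?d k) has_sum (1 / (1 - q) + q / (1 - q) + - 1)) UNIV"
    by (intro has_sum_add has_sum_uminusI d geometric_int_has_sum q)
  have b: "\<bar>?t k + - ?d k\<bar> \<le> q ^ nat \<bar>k\<bar> + - ?d k" for k
  proof (cases "k = 0")
    case False
    have "nat \<bar>k\<bar> \<le> nat \<bar>k\<bar> ^ 2" using False by (intro self_le_power) auto
    then have "real (nat \<bar>k\<bar>) \<le> real (nat \<bar>k\<bar> ^ 2)" by (simp only: of_nat_le_iff)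
    then have "real (nat \<bar>k\<bar>) \<le> (real_of_int k)\<^sup>2" by simp
    then have "q powr ((real_of_int k)\<^sup>2) \<le> q powr real (nat \<bar>k\<bar>)"
      using q by (intro powr_mono') auto
    also have "\<dots> = q ^ nat \<bar>k\<bar>" using q by (simp only: powr_realpow)
    finally have "q powr ((real_of_int k)\<^sup>2) * \<bar>cos (2 * pi * real_of_int k * u)\<bar> \<le> q ^ nat \<bar>k\<bar> * 1"
      using q by (intro mult_mono) auto
    then show ?thesis using False by (simp add: abs_mult)
  qed (use q in simp)
  have "jtheta 0 q u + - 1 \<le> 1 / (1 - q) + q / (1 - q) + - 1"
    by (rule has_sum_mono[OF T G]) (use b abs_le_D1 in blast)
  moreover have "- (jtheta 0 q u + - 1) \<le> 1 / (1 - q) + q / (1 - q) + - 1"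
    by (rule has_sum_mono[OF has_sum_uminusI[OF T] G]) (use b abs_le_D2 in blast)
  moreover have "1 / (1 - q) + q / (1 - q) + - 1 = 2 * q / (1 - q)"
    using q by (simp add: divide_simps)
  ultimately show ?thesis by linarith
qed

text \<open>The terms k = 0 and k = -1 give the lower bound. For the upper one, n = k or n = -k - 1
  turns the exponent into 1/4 + n + n^2 >= 1/4 + n.\<close>

lemma theta2_bounds:
  assumes q: "0 < q" "q < 1"
  shows "2 * q powr (1/4) \<le> theta2 q" "theta2 q \<le> 2 * q powr (1/4) / (1 - q)"
proof -
  let ?t = "\<lambda>k. q powr ((real_of_int k + 1/2)\<^sup>2)"
  have T: "(?t has_sum theta2 q) UNIV"
    using jtheta_has_sum[OF q, of "1/2" 0] by (simp add: theta2_jtheta)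
  have "sum ?t {0, -1} \<le> theta2 q"
    by (rule finite_sum_le_has_sum[OF T]) auto
  then show "2 * q powr (1/4) \<le> theta2 q"
    by (simp add: power2_eq_square)
  define g where "g = (\<lambda>k::int. q powr (1/4) * q ^ (if k \<ge> 0 then nat k else nat (- k - 1)))"
  have G: "(g has_sum (q powr (1/4) * (1 / (1 - q)) + q powr (1/4) * (1 / (1 - q)))) UNIV"
    by (rule has_sum_int; unfold g_def)
      (use has_sum_cmult_right[OF geometric_has_sum[OF q], of "q powr (1/4)"] in simp_all)
  have "theta2 q \<le> q powr (1/4) * (1 / (1 - q)) + q powr (1/4) * (1 / (1 - q))"
  proof (rule has_sum_mono[OF T G])
    fix k :: int
    define n where "n = (if k \<ge> 0 then nat k else nat (- k - 1))"
    have "real_of_int k = real n \<or> real_of_int k = - real n - 1" by (auto simp: n_def)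
    then have "(real_of_int k + 1/2)\<^sup>2 = 1/4 + real n + real n * real n"
      by (elim disjE; simp only: power2_eq_square; simp add: algebra_simps)
    then have "?t k \<le> q powr (1/4 + real n)"
      using q by (intro powr_mono') auto
    also have "\<dots> = g k"
      using q by (simp add: g_def n_def powr_add powr_realpow)
    finally show "?t k \<le> g k" .
  qed
  then show "theta2 q \<le> 2 * q powr (1/4) / (1 - q)" by simp
qed

section \<open>Behaviour under squaring of the nome\<close>

lemma square_in_unit: "0 < q \<Longrightarrow> q < 1 \<Longrightarrow> 0 < q\<^sup>2 \<and> q\<^sup>2 < (1::real)"
  by (simp add: power_less_one_iff)

lemma iterated_square_tendsto_0:
  fixes q :: real
  assumes "0 < q" "q < 1"
  shows "filterlim (\<lambda>n. q ^ 2 ^ n) (at_right 0) sequentially"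
proof -
  have "strict_mono (\<lambda>n. 2 ^ n :: nat)" by (simp add: strict_mono_def)
  moreover have "(\<lambda>n. q ^ n) \<longlonglongrightarrow> 0" using assms by (intro LIMSEQ_power_zero) auto
  ultimately have "(\<lambda>n. q ^ 2 ^ n) \<longlonglongrightarrow> 0"
    using LIMSEQ_subseq_LIMSEQ by (force simp: o_def)
  then show ?thesis
    using assms by (auto simp: filterlim_at intro!: always_eventually)
qed

lemma iterated_square_in_unit: "0 < q \<Longrightarrow> q < 1 \<Longrightarrow> 0 < q ^ 2 ^ n \<and> q ^ 2 ^ n < (1::real)"
  by (simp add: power_less_one_iff)

text \<open>Repeated squaring drives q to 0 without changing f, so f q is the limit at 0. Both
  identifications of the hypergeometric values rest on this.\<close>

lemma square_invariant_imp_const: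
  fixes f :: "real \<Rightarrow> real"
  assumes inv: "\<And>q. 0 < q \<Longrightarrow> q < 1 \<Longrightarrow> f (q\<^sup>2) = f q"
    and lim: "(f \<longlongrightarrow> l) (at_right 0)" and q: "0 < q" "q < 1"
  shows "f q = l"
proof -
  have "f (q ^ 2 ^ n) = f q" for n
  proof (induction n)
    case (Suc n)
    have "f (q ^ 2 ^ Suc n) = f ((q ^ 2 ^ n)\<^sup>2)"
      by (simp add: power_mult[symmetric] mult.commute)
    also have "\<dots> = f q"
      using inv[of "q ^ 2 ^ n"] iterated_square_in_unit[OF q, of n] Suc by simp
    finally show ?case .
  qed simp
  moreover have "(\<lambda>n. f (q ^ 2 ^ n)) \<longlonglongrightarrow> l"
    by (rule filterlim_compose[OF lim iterated_square_tendsto_0[OF q]])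
  ultimately show ?thesis
    using LIMSEQ_unique[of "\<lambda>_. f q" "f q" l] by simp
qed

lemma eventually_at_right_0_less: "0 < a \<Longrightarrow> eventually (\<lambda>q::real. 0 < q \<and> q < a) (at_right 0)"
  using eventually_at_right_real[of 0 a] by simp

lemma jtheta_0_tendsto: "((\<lambda>q. jtheta 0 q u) \<longlongrightarrow> 1) (at_right 0)"
proof -
  have "((\<lambda>q::real. 2 * q / (1 - q)) \<longlongrightarrow> 2 * 0 / (1 - 0)) (at_right 0)"
    by (intro tendsto_intros) auto
  then have lim: "((\<lambda>q::real. 2 * q / (1 - q)) \<longlongrightarrow> 0) (at_right 0)" by simp
  have "eventually (\<lambda>q. norm (jtheta 0 q u - 1) \<le> 2 * q / (1 - q)) (at_right 0)"
    by (rule eventually_mono[OF eventually_at_right_0_less[of 1]]) (auto intro!: jtheta_0_near_1)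
  then have "((\<lambda>q. jtheta 0 q u - 1) \<longlongrightarrow> 0) (at_right 0)"
    using lim by (rule Lim_null_comparison)
  then show ?thesis by (rule LIM_zero_cancel)
qed

lemma theta3_tendsto: "(theta3 \<longlongrightarrow> 1) (at_right 0)"
  using jtheta_0_tendsto[of 0] by (simp add: theta3_jtheta[abs_def])

lemma theta2_tendsto: "(theta2 \<longlongrightarrow> 0) (at_right 0)"
proof (rule tendsto_sandwich)
  show "((\<lambda>q. 0) \<longlongrightarrow> (0::real)) (at_right 0)" by simp
  have "((\<lambda>q::real. q powr (1/4)) \<longlongrightarrow> 0 powr (1/4)) (at_right 0)"
  proof (rule tendsto_powr')
    have "eventually (\<lambda>q::real. 0 \<le> q) (at_right 0)"
      by (rule eventually_mono[OF eventually_at_right_0_less[of 1]]) auto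
    then show "0 \<noteq> (0::real) \<or> 0 < (1/4::real) \<and> eventually (\<lambda>q::real. 0 \<le> q) (at_right 0)" by simp
  qed (intro tendsto_intros)+
  then have "((\<lambda>q::real. 2 * q powr (1/4) / (1 - q)) \<longlongrightarrow> 2 * 0 powr (1/4) / (1 - 0)) (at_right 0)"
    by (intro tendsto_divide tendsto_mult tendsto_diff tendsto_const tendsto_ident_at) auto
  then show "((\<lambda>q::real. 2 * q powr (1/4) / (1 - q)) \<longlongrightarrow> 0) (at_right 0)" by simp
  show "eventually (\<lambda>q. theta2 q \<le> 2 * q powr (1/4) / (1 - q)) (at_right 0)"
    by (rule eventually_mono[OF eventually_at_right_0_less[of 1]]) (auto intro!: theta2_bounds)
  show "eventually (\<lambda>q. 0 \<le> theta2 q) (at_right 0)"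
    by (rule eventually_mono[OF eventually_at_right_0_less[of 1]]) (auto intro!: order_trans[OF _ theta2_bounds(1)])
qed

section \<open>Theta-null identities between the nomes q and q^2, and positivity\<close>

lemma theta3_ge_1:
  assumes q: "0 < q" "q < 1"
  shows "theta3 q \<ge> 1"
proof -
  have "((\<lambda>k. q powr (real_of_int k)\<^sup>2) has_sum theta3 q) UNIV"
    using jtheta_has_sum[OF q, of 0 0] by (simp add: theta3_jtheta)
  from finite_sum_le_has_sum[OF this, of "{0}"] show ?thesis using q by simp
qed

lemma theta2_pos: "0 < q \<Longrightarrow> q < 1 \<Longrightarrow> theta2 q > 0"
  by (rule less_le_trans[OF _ theta2_bounds(1)]) auto

lemma theta3_square: "0 < q \<Longrightarrow> q < 1 \<Longrightarrow> (theta3 q)\<^sup>2 = (theta3 (q\<^sup>2))\<^sup>2 + (theta2 (q\<^sup>2))\<^sup>2"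
  using jtheta_mult_0[of q 0 0] by (simp add: theta3_jtheta theta2_jtheta power2_eq_square)

lemma theta4_square: "0 < q \<Longrightarrow> q < 1 \<Longrightarrow> (theta4 q)\<^sup>2 = (theta3 (q\<^sup>2))\<^sup>2 - (theta2 (q\<^sup>2))\<^sup>2"
  using jtheta_mult_0[of q "1/2" "1/2"] jtheta_0_plus_1[of "q\<^sup>2" 0] jtheta_half_plus_1[of "q\<^sup>2" 0]
  by (simp add: theta3_jtheta theta2_jtheta theta4_jtheta power2_eq_square)

text \<open>With v = u + 1/2 the half-integer term of the product formula contains
  \<open>jtheta (1/2)\<close> at -1/2, which is 0.\<close>

lemma jtheta_0_shift_product:
  assumes "0 < q" "q < 1"
  shows "jtheta 0 q u * jtheta 0 q (u + 1/2) = jtheta 0 (q\<^sup>2) (2 * u + 1/2) * theta4 (q\<^sup>2)"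
  using jtheta_mult_0[OF assms, of u "u + 1/2"] jtheta_half_half[of "q\<^sup>2"] jtheta_minus[of 0 "q\<^sup>2" "1/2"]
  by (simp add: theta4_jtheta)

lemma theta3_theta4: "0 < q \<Longrightarrow> q < 1 \<Longrightarrow> theta3 q * theta4 q = (theta4 (q\<^sup>2))\<^sup>2"
  using jtheta_0_shift_product[of q 0] by (simp add: theta3_jtheta theta4_jtheta power2_eq_square)

text \<open>
  Product and sum of the values at \<open>u\<close> and \<open>u + 1/2\<close> are positive as soon as the theta functions of
  nomes \<open>q\<^sup>2\<close> and \<open>q\<^sup>4\<close> are, so positivity descends from small nomes.
\<close>

lemma jtheta_0_pos:
  assumes "0 < q" "q < 1"
  shows "jtheta 0 q u > 0"
proof -
  \<comment> \<open>The step to level n uses both levels n + 1 and n + 2, so positivity is assumed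
    at all m >= n at once.\<close>
  have "\<forall>m\<ge>n. \<forall>u. jtheta 0 (q ^ 2 ^ m) u > 0 \<Longrightarrow> \<forall>u. jtheta 0 q u > 0" for n
  proof (induction n)
    case 0
    from this[rule_format, of 0] show ?case by simp
  next
    case (Suc n)
    have "\<forall>u. jtheta 0 (q ^ 2 ^ n) u > 0"
    proof
      fix u
      define r where "r = q ^ 2 ^ n"
      have r: "0 < r" "r < 1" using iterated_square_in_unit[OF assms] by (auto simp: r_def)
      have r2: "r\<^sup>2 = q ^ 2 ^ Suc n" by (simp add: r_def power_mult[symmetric] mult.commute)
      have "r ^ 4 = (r\<^sup>2)\<^sup>2" by simp
      then have r4: "r ^ 4 = q ^ 2 ^ Suc (Suc n)" by (simp add: r_def power_mult[symmetric] mult.commute)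
      have "jtheta 0 (r\<^sup>2) v > 0" "jtheta 0 (r ^ 4) v > 0" for v
        using Suc.prems[rule_format, of "Suc n"] Suc.prems[rule_format, of "Suc (Suc n)"] unfolding r2 r4 by auto
      then have "jtheta 0 r u * jtheta 0 r (u + 1/2) > 0" "jtheta 0 r u + jtheta 0 r (u + 1/2) > 0"
        unfolding jtheta_0_shift_product[OF r] jtheta_0_shift_sum[OF r] theta4_jtheta by simp_all
      then show "jtheta 0 (q ^ 2 ^ n) u > 0"
        unfolding r_def[symmetric] by (auto simp: zero_less_mult_iff)
    qed
    then have "\<forall>m\<ge>n. \<forall>u. jtheta 0 (q ^ 2 ^ m) u > 0"
      using Suc.prems by (metis le_antisym not_less_eq_eq)
    then show ?case by (rule Suc.IH)
  qed
  moreover have "\<exists>n. \<forall>m\<ge>n. \<forall>u. jtheta 0 (q ^ 2 ^ m) u > 0"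
  proof -
    have "eventually (\<lambda>r::real. 0 < r \<and> r < 1/4) (at_right 0)"
      by (rule eventually_at_right_0_less) simp
    then have "eventually (\<lambda>n. 0 < q ^ 2 ^ n \<and> q ^ 2 ^ n < 1/4) sequentially"
      using iterated_square_tendsto_0[OF assms] by (rule eventually_compose_filterlim)
    then obtain n where n: "\<And>m. m \<ge> n \<Longrightarrow> 0 < q ^ 2 ^ m \<and> q ^ 2 ^ m < 1/4"
      by (auto simp: eventually_sequentially)
    \<comment> \<open>For r < 1/4 the deviation bound 2r/(1 - r) from the value 1 is below
      2/3.\<close>
    have "jtheta 0 r u > 0" if "0 < r" "r < 1/4" for r u
    proof -
      have "2 * r / (1 - r) < 1" using that by (simp add: field_simps)
      then show ?thesis using jtheta_0_near_1[of r u] that by linarith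
    qed
    then show ?thesis using n by blast
  qed
  ultimately show ?thesis by blast
qed

lemma theta4_pos: "0 < q \<Longrightarrow> q < 1 \<Longrightarrow> theta4 q > 0"
  by (simp add: theta4_jtheta jtheta_0_pos)

text \<open>With r = \<open>sqrt q\<close>, the fourth power of theta_4(q) is theta_3(r)^2
  theta_4(r)^2, and the doubling formulas make this a difference of two squares.\<close>

lemma jacobi_theta_identity:
  assumes "0 < q" "q < 1"
  shows "theta2 q ^ 4 + theta4 q ^ 4 = theta3 q ^ 4"
proof -
  define r where "r = sqrt q"
  have r: "0 < r" "r < 1" "r\<^sup>2 = q" using assms by (auto simp: r_def)
  have "theta4 q ^ 4 = ((theta4 q)\<^sup>2)\<^sup>2" by simp
  also have "\<dots> = (theta3 r)\<^sup>2 * (theta4 r)\<^sup>2"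
    using theta3_theta4[OF r(1,2)] unfolding r(3) by (simp only: power_mult_distrib[symmetric])
  also have "\<dots> = ((theta3 q)\<^sup>2 + (theta2 q)\<^sup>2) * ((theta3 q)\<^sup>2 - (theta2 q)\<^sup>2)"
    by (simp add: theta3_square[OF r(1,2)] theta4_square[OF r(1,2)] r)
  finally show ?thesis by (simp add: algebra_simps power4_eq_xxxx power2_eq_square)
qed

section \<open>Modulus and complementary modulus as functions of the nome\<close>

definition nome_k :: "real \<Rightarrow> real" where
  "nome_k q = (theta2 q)\<^sup>2 / (theta3 q)\<^sup>2"

definition nome_k' :: "real \<Rightarrow> real" where
  "nome_k' q = (theta4 q)\<^sup>2 / (theta3 q)\<^sup>2"

lemma nome_k_pos: "0 < q \<Longrightarrow> q < 1 \<Longrightarrow> nome_k q > 0"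
  using theta2_pos[of q] theta3_ge_1[of q] by (simp add: nome_k_def)

lemma nome_k'_pos: "0 < q \<Longrightarrow> q < 1 \<Longrightarrow> nome_k' q > 0"
  using theta4_pos[of q] theta3_ge_1[of q] by (simp add: nome_k'_def)

lemma nome_k_k':
  assumes "0 < q" "q < 1"
  shows "(nome_k q)\<^sup>2 + (nome_k' q)\<^sup>2 = 1"
proof -
  have "(nome_k q)\<^sup>2 + (nome_k' q)\<^sup>2 = (theta2 q ^ 4 + theta4 q ^ 4) / theta3 q ^ 4"
    by (simp add: nome_k_def nome_k'_def power_divide add_divide_distrib)
  then show ?thesis
    using jacobi_theta_identity[OF assms] theta3_ge_1[OF assms] by simp
qed

lemma nome_k_less_1:
  assumes "0 < q" "q < 1"
  shows "nome_k q < 1"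
proof -
  have "(nome_k' q)\<^sup>2 > 0" using nome_k'_pos[OF assms] by simp
  then have "(nome_k q)\<^sup>2 < 1\<^sup>2" using nome_k_k'[OF assms] unfolding one_power2 by linarith
  then show ?thesis by (rule power2_less_imp_less) simp
qed

lemma nome_k'_less_1:
  assumes "0 < q" "q < 1"
  shows "nome_k' q < 1"
proof -
  have "(nome_k q)\<^sup>2 > 0" using nome_k_pos[OF assms] by simp
  then have "(nome_k' q)\<^sup>2 < 1\<^sup>2" using nome_k_k'[OF assms] unfolding one_power2 by linarith
  then show ?thesis by (rule power2_less_imp_less) simp
qed

text \<open>The right-hand side is the argument in \<open>ellF_landen\<close> at x =
  \<open>nome_k (q\<^sup>2)\<close>, so squaring the nome is a Landen step.\<close>

lemma nome_k_square:
  assumes "0 < q" "q < 1"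
  shows "(nome_k q)\<^sup>2 = 4 * nome_k (q\<^sup>2) / (1 + nome_k (q\<^sup>2))\<^sup>2"
proof -
  have Q: "0 < q\<^sup>2" "q\<^sup>2 < 1" using square_in_unit assms by auto
  define A C where "A = (theta3 (q\<^sup>2))\<^sup>2" and "C = (theta2 (q\<^sup>2))\<^sup>2"
  have AC: "A > 0" "C > 0" using theta3_ge_1[OF Q] theta2_pos[OF Q] by (auto simp: A_def C_def)
  have k': "nome_k' q = (A - C) / (A + C)"
    using assms by (simp add: nome_k'_def theta3_square theta4_square A_def C_def)
  have "(nome_k q)\<^sup>2 = 1 - ((A - C) / (A + C))\<^sup>2"
    using nome_k_k'[OF assms] by (simp add: k'[symmetric])
  also have "\<dots> = ((A + C)\<^sup>2 - (A - C)\<^sup>2) / (A + C)\<^sup>2"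
    using AC unfolding power_divide diff_divide_distrib[of "(A + C)\<^sup>2"] by simp
  also have "\<dots> = 4 * (C / A) / (1 + C / A)\<^sup>2"
  proof -
    have "1 + C / A = (A + C) / A" using AC by (simp add: field_simps)
    moreover have "(A + C)\<^sup>2 - (A - C)\<^sup>2 = 4 * C * A"
      by (simp add: power2_eq_square algebra_simps)
    ultimately show ?thesis using AC by (simp add: power_divide power2_eq_square)
  qed
  finally show ?thesis by (simp add: nome_k_def A_def C_def)
qed

lemma theta3_square_double:
  assumes "0 < q" "q < 1"
  shows "(theta3 q)\<^sup>2 = (1 + nome_k (q\<^sup>2)) * (theta3 (q\<^sup>2))\<^sup>2"
  using theta3_ge_1[of "q\<^sup>2"] square_in_unit[OF assms] theta3_square[OF assms]
  by (simp add: nome_k_def distrib_right)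

lemma theta3_double:
  assumes "0 < q" "q < 1"
  shows "(theta3 (q\<^sup>2))\<^sup>2 = (1 + nome_k' q) / 2 * (theta3 q)\<^sup>2"
  using theta3_ge_1[OF assms] theta3_square[OF assms] theta4_square[OF assms]
  by (simp add: nome_k'_def distrib_right)

text \<open>The same Landen step for the complementary modulus runs in the opposite direction: here
  the value at q^2 is expressed by the one at q.\<close>

lemma nome_k'_double:
  assumes "0 < q" "q < 1"
  shows "(nome_k' (q\<^sup>2))\<^sup>2 = 4 * nome_k' q / (1 + nome_k' q)\<^sup>2"
proof -
  have "nome_k' (q\<^sup>2) = theta3 q * theta4 q / ((1 + nome_k' q) / 2 * (theta3 q)\<^sup>2)"
    unfolding nome_k'_def[of "q\<^sup>2"] theta3_double[OF assms] theta3_theta4[OF assms] ..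
  also have "\<dots> = 2 * (theta4 q / theta3 q) / (1 + nome_k' q)"
    using theta3_ge_1[OF assms] by (simp add: power2_eq_square mult.commute)
  finally show ?thesis
    by (simp add: nome_k'_def power_divide power_mult_distrib)
qed

section \<open>The modulus and the period ratio\<close>

lemma theta3_square_eq_ellF:
  assumes "0 < q" "q < 1"
  shows "(theta3 q)\<^sup>2 = ellF ((nome_k q)\<^sup>2)"
proof -
  have F1: "ellF ((nome_k q)\<^sup>2) \<ge> 1" if "0 < q" "q < 1" for q
    using nome_k_pos[OF that] nome_k_less_1[OF that] by (intro ellF_ge_1) (auto simp: power_less_one_iff)
  have "(theta3 q)\<^sup>2 / ellF ((nome_k q)\<^sup>2) = 1"
  proof (rule square_invariant_imp_const[OF _ _ assms])
    fix q :: real assume q: "0 < q" "q < 1"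
    have Q: "0 < q\<^sup>2" "q\<^sup>2 < 1" using square_in_unit q by auto
    let ?x = "nome_k (q\<^sup>2)"
    have "ellF ((nome_k q)\<^sup>2) = (1 + ?x) * ellF (?x\<^sup>2)"
      unfolding nome_k_square[OF q] using nome_k_pos[OF Q] nome_k_less_1[OF Q] by (intro ellF_landen) auto
    then show "(theta3 (q\<^sup>2))\<^sup>2 / ellF (?x\<^sup>2) = (theta3 q)\<^sup>2 / ellF ((nome_k q)\<^sup>2)"
      using theta3_square_double[OF q] nome_k_pos[OF Q] by simp
  next
    have "(nome_k \<longlongrightarrow> 0\<^sup>2 / 1\<^sup>2) (at_right 0)"
      unfolding nome_k_def[abs_def] by (intro tendsto_intros theta2_tendsto theta3_tendsto) auto
    then have k: "((\<lambda>q. (nome_k q)\<^sup>2) \<longlongrightarrow> 0) (at_right 0)"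
      using tendsto_power[of nome_k 0 _ 2] by simp
    have "isCont ellF 0"
    proof (rule ellF_ode)
      fix F'
      assume "\<And>x. \<bar>x\<bar> < 1 \<Longrightarrow> (ellF has_real_derivative F' x) (at x)"
      from this[of 0] show "isCont ellF 0" by (auto intro: DERIV_isCont)
    qed
    then have "((\<lambda>q. ellF ((nome_k q)\<^sup>2)) \<longlongrightarrow> ellF 0) (at_right 0)"
      using k by (rule isCont_tendsto_compose)
    then have "((\<lambda>q. (theta3 q)\<^sup>2 / ellF ((nome_k q)\<^sup>2)) \<longlongrightarrow> 1\<^sup>2 / ellF 0) (at_right 0)"
      by (intro tendsto_intros theta3_tendsto) auto
    then show "((\<lambda>q. (theta3 q)\<^sup>2 / ellF ((nome_k q)\<^sup>2)) \<longlongrightarrow> 1) (at_right 0)" by simp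
  qed
  then show ?thesis using F1[OF assms] by simp
qed

text \<open>The quotient K'/K of the complete elliptic integrals for the modulus x.\<close>

definition period_ratio :: "real \<Rightarrow> real" where
  "period_ratio x = ellF (1 - x\<^sup>2) / ellF (x\<^sup>2)"

lemma period_ratio_strict_antimono:
  assumes "0 < x" "x < y" "y < 1"
  shows "period_ratio y < period_ratio x"
proof -
  have sq: "x\<^sup>2 < y\<^sup>2" "y\<^sup>2 < 1" "0 < x\<^sup>2"
    using assms by (auto simp: power_less_one_iff intro!: power_strict_mono)
  have "ellF (1 - y\<^sup>2) < ellF (1 - x\<^sup>2)" "ellF (x\<^sup>2) < ellF (y\<^sup>2)"
    using sq by (auto intro!: ellF_strict_mono)
  moreover have "ellF (1 - y\<^sup>2) \<ge> 1" "ellF (x\<^sup>2) \<ge> 1"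
    using sq by (auto intro!: ellF_ge_1)
  ultimately show ?thesis
    unfolding period_ratio_def by (intro frac_less) auto
qed

lemma period_ratio_inject:
  assumes "x \<in> {0<..<1}" "y \<in> {0<..<1}" "period_ratio x = period_ratio y"
  shows "x = y"
  using assms period_ratio_strict_antimono[of x y] period_ratio_strict_antimono[of y x]
  by (cases x y rule: linorder_cases) auto

text \<open>Only a bounded difference between ln k^2 and ln q is wanted, so crude constants suffice:
  theta_3 <= 2 yields the factor 1, and theta_3 >= 1 with 1 - q > 2/3 yields 3^4 = 81.\<close>

lemma nome_k_bounds:
  assumes "0 < q" "q < 1/3"
  shows "q \<le> (nome_k q)\<^sup>2" "(nome_k q)\<^sup>2 \<le> 81 * q"
proof -
  have q1: "q < 1" using assms by simp
  have k: "(nome_k q)\<^sup>2 = (theta2 q / theta3 q) ^ 4"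
    by (simp add: nome_k_def power_divide)
  have p: "(q powr (1/4)) ^ 4 = q"
    using assms by (simp add: powr_realpow[symmetric] powr_powr)
  have "2 * q / (1 - q) \<le> 1" using assms by (simp add: field_simps)
  then have t: "1 \<le> theta3 q" "theta3 q \<le> 2"
    using jtheta_0_near_1[OF assms(1) q1, of 0] theta3_ge_1[OF assms(1) q1] unfolding theta3_jtheta by linarith+
  have "2 * q powr (1/4) / 2 \<le> theta2 q / theta3 q"
    using theta2_bounds[OF assms(1) q1] t by (intro frac_le) (auto intro: order_trans[OF _ theta2_bounds(1)[OF assms(1) q1]])
  then have "(q powr (1/4)) ^ 4 \<le> (theta2 q / theta3 q) ^ 4"
    by (intro power_mono) auto
  then show "q \<le> (nome_k q)\<^sup>2" by (simp only: p k)
  have "theta2 q / theta3 q \<le> theta2 q / 1"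
    using t theta2_pos[OF assms(1) q1] by (intro divide_left_mono) auto
  also have "\<dots> \<le> 2 * q powr (1/4) / (1 - q)"
    using theta2_bounds[OF assms(1) q1] by simp
  also have "\<dots> \<le> 2 * q powr (1/4) / (2/3)"
    using assms by (intro divide_left_mono) auto
  finally have "(theta2 q / theta3 q) ^ 4 \<le> (3 * q powr (1/4)) ^ 4"
    using t theta2_pos[OF assms(1) q1] by (intro power_mono) auto
  then show "(nome_k q)\<^sup>2 \<le> 81 * q" by (simp only: p k power_mult_distrib) simp
qed

lemma period_ratio_nome_k:
  assumes "0 < q" "q < 1"
  shows "period_ratio (nome_k q) = - ln q / pi"
proof -
  have k': "1 - (nome_k q)\<^sup>2 = (nome_k' q)\<^sup>2" if "0 < q" "q < 1" for q
    using nome_k_k'[OF that] by simp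
  have "period_ratio (nome_k q) / (- ln q) = 1 / pi"
  proof (rule square_invariant_imp_const[OF _ _ assms])
    fix q :: real assume q: "0 < q" "q < 1"
    have Q: "0 < q\<^sup>2" "q\<^sup>2 < 1" using square_in_unit q by auto
    let ?x = "nome_k' q"
    have x: "0 < ?x" "?x < 1" using nome_k'_pos[OF q] nome_k'_less_1[OF q] by auto
    \<comment> \<open>Under q -> q^2, F(k'^2) gains the factor 1 + k'(q) and F(k^2) the factor (1 +
      k'(q))/2, so their ratio doubles, exactly as - ln q does.\<close>
    have "ellF ((nome_k' (q\<^sup>2))\<^sup>2) = (1 + ?x) * ellF (?x\<^sup>2)"
      unfolding nome_k'_double[OF q] using x by (intro ellF_landen) auto
    then have "period_ratio (nome_k (q\<^sup>2)) = (1 + ?x) * ellF (?x\<^sup>2) / ((1 + ?x) / 2 * (theta3 q)\<^sup>2)"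
      by (simp only: period_ratio_def k'[OF Q] theta3_square_eq_ellF[OF Q, symmetric] theta3_double[OF q])
    also have "\<dots> = 2 * period_ratio (nome_k q)"
      using x unfolding period_ratio_def k'[OF q] theta3_square_eq_ellF[OF q, symmetric] by simp
    finally show "period_ratio (nome_k (q\<^sup>2)) / (- ln (q\<^sup>2)) = period_ratio (nome_k q) / (- ln q)"
      using q by (simp add: ln_realpow)
  next
    have inv: "((\<lambda>q::real. inverse (ln q)) \<longlongrightarrow> 0) (at_right 0)"
      by (rule filterlim_compose[OF tendsto_inverse_0 filterlim_mono[OF ln_at_0 at_bot_le_at_infinity order_refl]])
    \<comment> \<open>With q <= k^2 <= 81 q, the logarithmic bounds on F give - ln q / pi up to a
      bounded error, which division by - ln q removes in the limit.\<close>
    have num: "((\<lambda>q. ellF (1 - (nome_k q)\<^sup>2) * (- inverse (ln q))) \<longlongrightarrow> 1 / pi) (at_right 0)"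
    proof (rule tendsto_sandwich)
      show "((\<lambda>q. 1 / pi + ln 81 / pi * inverse (ln q)) \<longlongrightarrow> 1 / pi) (at_right 0)"
        using tendsto_add[OF tendsto_const[of "1 / pi"] tendsto_mult[OF tendsto_const[of "ln 81 / pi"] inv]] by simp
      show "((\<lambda>q. 1 / pi - inverse (ln q)) \<longlongrightarrow> 1 / pi) (at_right 0)"
        using tendsto_diff[OF tendsto_const[of "1 / pi"] inv] by simp
      have b: "1 / pi + ln 81 / pi * inverse (ln q) \<le> ellF (1 - (nome_k q)\<^sup>2) * (- inverse (ln q)) \<and>
         ellF (1 - (nome_k q)\<^sup>2) * (- inverse (ln q)) \<le> 1 / pi - inverse (ln q)" if q: "0 < q \<and> q < 1/3" for q
      proof -
        have q': "0 < q" "q < 1/3" "q < 1" using q by auto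
        define x where "x = (nome_k q)\<^sup>2"
        have x: "0 < x" "x < 1" using nome_k_pos[of q] nome_k_less_1[of q] q' by (auto simp: x_def power_less_one_iff)
        have bx: "q \<le> x" "x \<le> 81 * q" using nome_k_bounds[OF q'(1,2)] by (auto simp: x_def)
        have l: "ln q \<le> ln x" "ln x \<le> ln 81 + ln q"
          using bx x q' ln_mono[of x "81 * q"] ln_mono[of q x] by (auto simp: ln_mult)
        have neg: "ln q < 0" using q' by simp
        have F: "- ln x / pi \<le> ellF (1 - x)" "ellF (1 - x) \<le> 1 - ln x / pi"
          using ellF_log_bounds[of "1 - x"] x by auto
        have "- (ln 81 + ln q) / pi \<le> - ln x / pi" "- ln x / pi \<le> - ln q / pi"
          using l by (intro divide_right_mono; simp)+
        with F have "- (ln 81 + ln q) / pi \<le> ellF (1 - x)" "ellF (1 - x) \<le> 1 - ln q / pi" by auto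
        moreover have "- inverse (ln q) \<ge> 0" using neg by simp
        ultimately have "- (ln 81 + ln q) / pi * (- inverse (ln q)) \<le> ellF (1 - x) * (- inverse (ln q))"
          "ellF (1 - x) * (- inverse (ln q)) \<le> (1 - ln q / pi) * (- inverse (ln q))"
          by (auto simp only: intro!: mult_right_mono)
        moreover have "- (ln 81 + ln q) / pi * (- inverse (ln q)) = 1 / pi + ln 81 / pi * inverse (ln q)"
          "(1 - ln q / pi) * (- inverse (ln q)) = 1 / pi - inverse (ln q)"
          using neg by (simp_all add: field_simps)
        ultimately show ?thesis unfolding x_def[symmetric] by (intro conjI; linarith)
      qed
      have ev: "eventually (\<lambda>q::real. 0 < q \<and> q < 1/3) (at_right 0)"
        by (rule eventually_at_right_0_less) simp
      show "eventually (\<lambda>q. 1 / pi + ln 81 / pi * inverse (ln q) \<le> ellF (1 - (nome_k q)\<^sup>2) * (- inverse (ln q))) (at_right 0)"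
        by (rule eventually_mono[OF ev]) (rule conjunct1[OF b])
      show "eventually (\<lambda>q. ellF (1 - (nome_k q)\<^sup>2) * (- inverse (ln q)) \<le> 1 / pi - inverse (ln q)) (at_right 0)"
        by (rule eventually_mono[OF ev]) (rule conjunct2[OF b])
    qed
    have "((\<lambda>q. ellF (1 - (nome_k q)\<^sup>2) * (- inverse (ln q)) / (theta3 q)\<^sup>2) \<longlongrightarrow> 1 / pi / 1\<^sup>2) (at_right 0)"
      by (rule tendsto_divide[OF num tendsto_power[OF theta3_tendsto]]) simp
    then have "((\<lambda>q. ellF (1 - (nome_k q)\<^sup>2) * (- inverse (ln q)) / (theta3 q)\<^sup>2) \<longlongrightarrow> 1 / pi) (at_right 0)"
      by simp
    then show "((\<lambda>q. period_ratio (nome_k q) / (- ln q)) \<longlongrightarrow> 1 / pi) (at_right 0)"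
    proof (rule Lim_transform_eventually)
      show "eventually (\<lambda>q. ellF (1 - (nome_k q)\<^sup>2) * (- inverse (ln q)) / (theta3 q)\<^sup>2
          = period_ratio (nome_k q) / (- ln q)) (at_right 0)"
      proof (rule eventually_mono[OF eventually_at_right_0_less[of 1]])
        fix q :: real assume "0 < q \<and> q < 1"
        then have "(theta3 q)\<^sup>2 = ellF ((nome_k q)\<^sup>2)" by (simp add: theta3_square_eq_ellF)
        then show "ellF (1 - (nome_k q)\<^sup>2) * (- inverse (ln q)) / (theta3 q)\<^sup>2
            = period_ratio (nome_k q) / (- ln q)"
          by (simp only: period_ratio_def divide_inverse inverse_minus_eq mult_ac)
      qed simp
    qed
  qed
  then have "period_ratio (nome_k q) = 1 / pi * (- ln q)"
    using assms by (simp only: divide_eq_eq) simp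
  then show ?thesis by simp
qed

section \<open>Passage from the nome to alpha\<close>

lemma exp_nome: "0 < \<alpha> \<Longrightarrow> 0 < exp (- pi * \<alpha>\<^sup>2) \<and> exp (- pi * \<alpha>\<^sup>2) < 1" for \<alpha> :: real
  by simp

lemma modk_nome: "modk \<alpha> = nome_k (exp (- pi * \<alpha>\<^sup>2))"
  by (simp add: modk_def nome_k_def)

lemma modk'_nome: "modk' \<alpha> = nome_k' (exp (- pi * \<alpha>\<^sup>2))"
  by (simp add: modk'_def nome_k'_def)

lemma modk_range: "\<alpha> > 0 \<Longrightarrow> modk \<alpha> \<in> {0<..<1}"
  using exp_nome[of \<alpha>] nome_k_pos nome_k_less_1 by (simp add: modk_nome)

lemma modk'_range: "\<alpha> > 0 \<Longrightarrow> modk' \<alpha> \<in> {0<..<1}"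
  using exp_nome[of \<alpha>] nome_k'_pos nome_k'_less_1 by (simp add: modk'_nome)

lemma modk_modk': "\<alpha> > 0 \<Longrightarrow> (modk \<alpha>)\<^sup>2 + (modk' \<alpha>)\<^sup>2 = 1"
  using exp_nome[of \<alpha>] nome_k_k' by (simp add: modk_nome modk'_nome)

lemma period_ratio_modk: "\<alpha> > 0 \<Longrightarrow> period_ratio (modk \<alpha>) = \<alpha>\<^sup>2"
  using exp_nome[of \<alpha>] period_ratio_nome_k by (simp add: modk_nome)

text \<open>Exchanging k and k' inverts the period ratio alpha^2, as does alpha -> 1/alpha; the
  period ratio determines the modulus.\<close>

lemma modk_inverse:
  assumes "\<alpha> > 0"
  shows "modk (1 / \<alpha>) = modk' \<alpha>"
proof (rule period_ratio_inject)
  have c: "1 - (modk \<alpha>)\<^sup>2 = (modk' \<alpha>)\<^sup>2" "1 - (modk' \<alpha>)\<^sup>2 = (modk \<alpha>)\<^sup>2"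
    using modk_modk'[OF assms] by auto
  have "period_ratio (modk' \<alpha>) = inverse (period_ratio (modk \<alpha>))"
    unfolding period_ratio_def c by simp
  then show "period_ratio (modk (1 / \<alpha>)) = period_ratio (modk' \<alpha>)"
    using assms by (simp add: period_ratio_modk power_divide inverse_eq_divide)
qed (use assms modk_range modk'_range in auto)

lemma bij_betw_modk': "bij_betw modk' {0<..} {0<..<1}"
proof (rule bij_betw_imageI)
  have pr: "period_ratio (modk' \<alpha>) = (1 / \<alpha>)\<^sup>2" if "\<alpha> > 0" for \<alpha>
    using that modk_inverse[OF that] period_ratio_modk[of "1 / \<alpha>"] by simp
  show "inj_on modk' {0<..}"
  proof (rule inj_onI)
    fix \<alpha> \<beta> :: real assume "\<alpha> \<in> {0<..}" "\<beta> \<in> {0<..}" and eq: "modk' \<alpha> = modk' \<beta>"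
    then have pos: "\<alpha> > 0" "\<beta> > 0" by simp_all
    have "(1 / \<alpha>)\<^sup>2 = (1 / \<beta>)\<^sup>2"
      unfolding pr[OF pos(1), symmetric] pr[OF pos(2), symmetric] eq ..
    then have "1 / \<alpha> = 1 / \<beta>"
      by (rule power2_eq_imp_eq) (use pos in simp_all)
    then show "\<alpha> = \<beta>" by simp
  qed
  show "modk' ` {0<..} = {0<..<1}"
  proof
    show "modk' ` {0<..} \<subseteq> {0<..<1}" by (rule image_subsetI) (rule modk'_range, simp)
    show "{0<..<1} \<subseteq> modk' ` {0<..}"
    proof
      fix x :: real assume x: "x \<in> {0<..<1}"
      then have "0 < x\<^sup>2" "x\<^sup>2 < 1" by (auto simp: power_less_one_iff)
      then have "ellF (1 - x\<^sup>2) \<ge> 1" "ellF (x\<^sup>2) \<ge> 1" by (auto intro!: ellF_ge_1)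
      then have p: "period_ratio x > 0" by (simp add: period_ratio_def)
      \<comment> \<open>Solves 1/alpha^2 = \<open>period_ratio x\<close>, the equation that
        \<open>pr\<close> imposes on a preimage of x.\<close>
      define \<alpha> where "\<alpha> = 1 / sqrt (period_ratio x)"
      have a: "\<alpha> > 0" "(1 / \<alpha>)\<^sup>2 = period_ratio x" using p by (auto simp: \<alpha>_def)
      have "modk' \<alpha> = x"
        by (rule period_ratio_inject[OF modk'_range[OF a(1)] x]) (simp only: pr[OF a(1)] a(2))
      moreover have "\<alpha> \<in> {0<..}" using a by simp
      ultimately show "x \<in> modk' ` {0<..}" by (metis imageI)
    qed
  qed
qed

section \<open>Extrema of the theta function\<close>

lemma jtheta_0_max:
  assumes q: "0 < q" "q < 1"
  shows "jtheta 0 q u \<le> theta3 q"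
  unfolding theta3_jtheta
  by (rule has_sum_mono[OF jtheta_has_sum[OF q] jtheta_has_sum[OF q]]) (auto intro!: mult_left_le)

text \<open>After squaring, the right side minus the left is 2 C S (c S - s C), and c S - s C is
  itself the square of \<open>jtheta (1/2) q (u + 1/2)\<close>. Thus f(u)/f(u + 1/2) is largest at u
  = 0.\<close>

lemma jtheta_0_shift_ratio:
  assumes q: "0 < q" "q < 1"
  shows "theta4 q * jtheta 0 q u \<le> theta3 q * jtheta 0 q (u + 1/2)"
proof (rule power2_le_imp_le)
  have Q: "0 < q\<^sup>2" "q\<^sup>2 < 1" using square_in_unit q by auto
  define c s C S where "c = jtheta 0 (q\<^sup>2) (2 * u)" and "s = jtheta (1/2) (q\<^sup>2) (2 * u)"
    and "C = theta3 (q\<^sup>2)" and "S = theta2 (q\<^sup>2)"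
  have u: "u + 1/2 + (u + 1/2) = 2 * u + 1" by simp
  have "(jtheta (1/2) q (u + 1/2))\<^sup>2 = c * S - s * C"
    using jtheta_mult_half[OF q, of "u + 1/2" "u + 1/2"] unfolding u jtheta_0_plus_1 jtheta_half_plus_1
    by (simp add: c_def s_def C_def S_def theta3_jtheta theta2_jtheta power2_eq_square)
  then have "0 \<le> c * S - s * C" by (metis zero_le_power2)
  moreover have "C > 0" "S > 0" using theta3_ge_1[OF Q] theta2_pos[OF Q] by (auto simp: C_def S_def)
  ultimately have "0 \<le> 2 * C * S * (c * S - s * C)" by simp
  moreover have "(jtheta 0 q u)\<^sup>2 = c * C + s * S"
    using jtheta_mult_0[OF q, of u u]
    by (simp add: c_def s_def C_def S_def theta3_jtheta theta2_jtheta power2_eq_square)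
  moreover have "(jtheta 0 q (u + 1/2))\<^sup>2 = c * C - s * S"
    using jtheta_mult_0[OF q, of "u + 1/2" "u + 1/2"] unfolding u jtheta_0_plus_1 jtheta_half_plus_1
    by (simp add: c_def s_def C_def S_def theta3_jtheta theta2_jtheta power2_eq_square)
  moreover have "(theta3 q)\<^sup>2 = C\<^sup>2 + S\<^sup>2" "(theta4 q)\<^sup>2 = C\<^sup>2 - S\<^sup>2"
    by (simp_all add: C_def S_def theta3_square[OF q] theta4_square[OF q])
  ultimately show "(theta4 q * jtheta 0 q u)\<^sup>2 \<le> (theta3 q * jtheta 0 q (u + 1/2))\<^sup>2"
    unfolding power_mult_distrib by (simp only:) (simp add: algebra_simps power2_eq_square)
  show "0 \<le> theta3 q * jtheta 0 q (u + 1/2)"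
    using theta3_ge_1[OF q] jtheta_0_pos[OF q, of "u + 1/2"] by simp
qed

text \<open>The ratio bound gives f(u)^2 >= (theta_4/theta_3) f(u) f(u + 1/2). The shift product and
  the assumed bound at q^2 make this at least c (theta_4/theta_3) theta_4(q^2)^2 = c
  theta_4(q)^2.\<close>

lemma jtheta_0_lower_bound_step:
  assumes q: "0 < q" "q < 1" and c: "0 < c" and "\<And>u. c * theta4 (q\<^sup>2) \<le> jtheta 0 (q\<^sup>2) u"
  shows "sqrt c * theta4 q \<le> jtheta 0 q u"
proof (rule power2_le_imp_le)
  have Q: "0 < q\<^sup>2" "q\<^sup>2 < 1" using square_in_unit q by auto
  have pos: "theta3 q > 0" "theta4 q > 0" "theta4 (q\<^sup>2) > 0" "jtheta 0 q u > 0"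
    using theta3_ge_1[OF q] theta4_pos[OF q] theta4_pos[OF Q] jtheta_0_pos[OF q] by auto
  have "theta3 q * (c * (theta4 q)\<^sup>2) = theta4 q * (c * theta4 (q\<^sup>2) * theta4 (q\<^sup>2))"
    using theta3_theta4[OF q] by (simp add: power2_eq_square mult_ac)
  also have "\<dots> \<le> theta4 q * (jtheta 0 (q\<^sup>2) (2 * u + 1/2) * theta4 (q\<^sup>2))"
    using pos assms(4) by (intro mult_left_mono mult_right_mono) auto
  also have "\<dots> = theta4 q * jtheta 0 q (u + 1/2) * jtheta 0 q u"
    by (simp add: jtheta_0_shift_product[OF q, symmetric])
  also have "\<dots> \<le> theta3 q * jtheta 0 q u * jtheta 0 q u"
    using jtheta_0_shift_ratio[OF q, of "u + 1/2"] jtheta_0_plus_1[of q u] pos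
    by (intro mult_right_mono) (auto simp: add.assoc)
  finally show "(sqrt c * theta4 q)\<^sup>2 \<le> (jtheta 0 q u)\<^sup>2"
    using pos c by (simp add: power_mult_distrib power2_eq_square[of "jtheta 0 q u"])
  show "0 \<le> jtheta 0 q u" using pos by simp
qed

lemma jtheta_0_min:
  assumes q: "0 < q" "q < 1"
  shows "theta4 q \<le> jtheta 0 q u"
proof -
  have iter: "c powr (1 / 2 ^ n) * theta4 q \<le> jtheta 0 q u"
    if "0 < c" "\<And>u. c * theta4 (q ^ 2 ^ n) \<le> jtheta 0 (q ^ 2 ^ n) u" for c n u
    using that
  proof (induction n arbitrary: c u)
    case (Suc n)
    have sq: "q ^ 2 ^ Suc n = (q ^ 2 ^ n)\<^sup>2" by (simp add: power_mult[symmetric] mult.commute)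
    have "sqrt c * theta4 (q ^ 2 ^ n) \<le> jtheta 0 (q ^ 2 ^ n) v" for v
      using Suc.prems iterated_square_in_unit[OF q, of n] unfolding sq
      by (intro jtheta_0_lower_bound_step) auto
    from Suc.IH[OF _ this] Suc.prems(1) have "sqrt c powr (1 / 2 ^ n) * theta4 q \<le> jtheta 0 q u" by simp
    moreover have "sqrt c powr (1 / 2 ^ n) = c powr (1 / 2 ^ Suc n)"
      using Suc.prems(1) by (simp add: powr_half_sqrt[symmetric] powr_powr)
    ultimately show ?case by simp
  qed simp
  \<comment> \<open>For r < 1/5 all values lie in [1/2, 3/2], so any two have ratio at least 1/3; n
    square roots turn this constant into (1/3)^(1/2^n), which tends to 1.\<close>
  have "eventually (\<lambda>r::real. 0 < r \<and> r < 1/5) (at_right 0)"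
    by (rule eventually_at_right_0_less) simp
  then have "eventually (\<lambda>n. 0 < q ^ 2 ^ n \<and> q ^ 2 ^ n < 1/5) sequentially"
    using iterated_square_tendsto_0[OF q] by (rule eventually_compose_filterlim)
  then have "eventually (\<lambda>n. (1/3) powr (1 / 2 ^ n) * theta4 q \<le> jtheta 0 q u) sequentially"
  proof (rule eventually_mono)
    fix n assume r: "0 < q ^ 2 ^ n \<and> q ^ 2 ^ n < 1/5"
    have "1/3 * theta4 (q ^ 2 ^ n) \<le> jtheta 0 (q ^ 2 ^ n) v" for v
    proof -
      have "2 * q ^ 2 ^ n / (1 - q ^ 2 ^ n) \<le> 1/2" using r by (simp add: field_simps)
      then show ?thesis
        using jtheta_0_near_1[of "q ^ 2 ^ n" v] jtheta_0_near_1[of "q ^ 2 ^ n" "1/2"] r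
        unfolding theta4_jtheta by linarith
    qed
    then show "(1/3) powr (1 / 2 ^ n) * theta4 q \<le> jtheta 0 q u" by (intro iter) auto
  qed
  moreover have "(\<lambda>n. (1/3) powr (1 / 2 ^ n) * theta4 q) \<longlonglongrightarrow> (1/3) powr 0 * theta4 q"
  proof (intro tendsto_intros)
    have "(\<lambda>n. (1/2::real) ^ n) \<longlonglongrightarrow> 0" by (intro LIMSEQ_power_zero) simp
    then show "(\<lambda>n. 1 / 2 ^ n :: real) \<longlonglongrightarrow> 0" by (simp add: power_one_over)
  qed auto
  ultimately show ?thesis
    using tendsto_upperbound[of _ "theta4 q" sequentially "jtheta 0 q u"] by simp
qed

section \<open>Factorization of the heat kernel, and the theorem\<close>

lemma heat_kernel_eq:
  assumes "\<alpha> > 0"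
  shows "heat_kernel \<alpha> x y 1 =
    of_real (jtheta 0 (exp (- pi * \<alpha>\<^sup>2)) x * jtheta 0 (exp (- pi * \<alpha> powr (-2))) y)"
proof -
  let ?q = "exp (- pi * \<alpha>\<^sup>2)" and ?q' = "exp (- pi * \<alpha> powr (-2))"
  have q: "0 < ?q" "?q < 1" "0 < ?q'" "?q' < 1" using assms by simp_all
  have s: "(\<lambda>k::int. norm (gwave q u (real_of_int k))) summable_on UNIV" if "0 < q" "q < 1" for q u
    using gauss_summable[OF that, of 0] by (simp add: gwave_def norm_mult)
  have w: "((\<lambda>k::int. gwave q u (real_of_int k)) has_sum of_real (jtheta 0 q u)) UNIV" if "0 < q" "q < 1" for q u
    using gwave_has_sum_int[OF that, of 0 u] by simp
  have "((\<lambda>(k, l). gwave ?q x (real_of_int k) * gwave ?q' y (real_of_int l)) has_sum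
      (of_real (jtheta 0 ?q x) * of_real (jtheta 0 ?q' y))) (UNIV \<times> UNIV)"
    using has_sum_times[OF w[OF q(1,2)] s[OF q(1,2)] w[OF q(3,4)] s[OF q(3,4)]] .
  moreover have "gwave ?q x (real_of_int k) * gwave ?q' y (real_of_int l) =
      complex_of_real (exp (- pi * 1 * (\<alpha>^2 * (real_of_int k)^2 + \<alpha> powr (-2) * (real_of_int l)^2)))
        * cis (2 * pi * (real_of_int k * x + real_of_int l * y))" for k l
  proof -
    have e: "?q powr ((real_of_int k)\<^sup>2) * ?q' powr ((real_of_int l)\<^sup>2)
        = exp (- pi * 1 * (\<alpha>^2 * (real_of_int k)^2 + \<alpha> powr (-2) * (real_of_int l)^2))"
      by (simp add: powr_def exp_add[symmetric] algebra_simps)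
    have c: "cis (2 * pi * real_of_int k * x) * cis (2 * pi * real_of_int l * y)
        = cis (2 * pi * (real_of_int k * x + real_of_int l * y))"
      by (simp add: cis_mult algebra_simps)
    show ?thesis
      unfolding gwave_def e[symmetric] c[symmetric] of_real_mult by (simp only: mult_ac)
  qed
  ultimately have "((\<lambda>(k, l). complex_of_real (exp (- pi * 1 * (\<alpha>^2 * (real_of_int k)^2 + \<alpha> powr (-2) * (real_of_int l)^2)))
        * cis (2 * pi * (real_of_int k * x + real_of_int l * y))) has_sum
      (of_real (jtheta 0 ?q x) * of_real (jtheta 0 ?q' y))) UNIV"
    by (simp only: UNIV_Times_UNIV)
  then show ?thesis
    unfolding heat_kernel_def of_real_mult by (rule infsumI)
qed

theorem mainTheorem4:
  fixes \<alpha> :: real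
  assumes "\<alpha> > 0"
  defines "q \<equiv> exp (- pi * \<alpha>^2)" and "q' \<equiv> exp (- pi * \<alpha> powr (-2))"
      and "k \<equiv> modk \<alpha>" and "k' \<equiv> modk' \<alpha>"
      and "p \<equiv> (\<lambda>(x, y). Re (heat_kernel \<alpha> x y 1))"
  shows "k \<in> {0<..<1} \<and> k' \<in> {0<..<1} \<and> k^2 + k'^2 = 1
    \<and> (\<forall>x y. heat_kernel \<alpha> x y 1 \<in> \<real>)
    \<and> is_min_value p (theta4 q * theta4 q')
    \<and> theta4 q * theta4 q' = theta2 q * theta2 q'
    \<and> theta2 q * theta2 q' = sqrt (k * k' * hyp2F1 (1/2) (1/2) 1 (k^2) * hyp2F1 (1/2) (1/2) 1 (k'^2))
    \<and> is_max_value p (theta3 q * theta3 q')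
    \<and> theta3 q * theta3 q' = sqrt (hyp2F1 (1/2) (1/2) 1 (k^2) * hyp2F1 (1/2) (1/2) 1 (k'^2))
    \<and> bij_betw modk' {0<..} {0<..<1}"
proof -
  have q: "0 < q" "q < 1" "0 < q'" "q' < 1"
    using assms by (simp_all add: q_def q'_def)
  have inv: "\<alpha> powr (-2) = (1 / \<alpha>)\<^sup>2"
    using assms(1) by (simp add: powr_minus power_divide inverse_eq_divide)
  have a': "1 / \<alpha> > 0" using assms(1) by simp
  have p: "p (x, y) = jtheta 0 q x * jtheta 0 q' y" for x y
    by (simp add: p_def q_def q'_def heat_kernel_eq[OF assms(1)])
  \<comment> \<open>The nome q' belongs to 1/alpha, so k and k' change places there.\<close>
  have k: "nome_k q = k" "nome_k' q = k'" "nome_k q' = k'" "nome_k' q' = k"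
    using modk_inverse[OF assms(1)] modk_inverse[OF a']
    by (simp_all add: k_def k'_def q_def q'_def inv modk_nome modk'_nome)
  have kr: "k \<in> {0<..<1}" "k' \<in> {0<..<1}"
    using modk_range modk'_range assms(1) by (auto simp: k_def k'_def)
  have pos: "theta2 q > 0" "theta2 q' > 0" "theta3 q > 0" "theta3 q' > 0" "theta4 q > 0" "theta4 q' > 0"
    using q theta2_pos theta4_pos theta3_ge_1[of q] theta3_ge_1[of q'] by auto
  have F: "ellF (k\<^sup>2) = (theta3 q)\<^sup>2" "ellF (k'\<^sup>2) = (theta3 q')\<^sup>2"
    using theta3_square_eq_ellF q k by auto
  \<comment> \<open>As theta_2 and theta_4 swap moduli between q and q', both of their products have
    the square k k' theta_3(q)^2 theta_3(q')^2.\<close>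
  have t2: "(theta2 q)\<^sup>2 = k * (theta3 q)\<^sup>2" "(theta2 q')\<^sup>2 = k' * (theta3 q')\<^sup>2"
    using k pos by (auto simp: nome_k_def field_simps)
  have t4: "(theta4 q)\<^sup>2 = k' * (theta3 q)\<^sup>2" "(theta4 q')\<^sup>2 = k * (theta3 q')\<^sup>2"
    using k pos by (auto simp: nome_k'_def field_simps)
  have e2: "theta2 q * theta2 q' = sqrt (k * k' * ellF (k\<^sup>2) * ellF (k'\<^sup>2))"
    using pos by (intro real_sqrt_unique[symmetric]) (auto simp: F power_mult_distrib t2)
  have e4: "theta4 q * theta4 q' = sqrt (k * k' * ellF (k\<^sup>2) * ellF (k'\<^sup>2))"
    using pos by (intro real_sqrt_unique[symmetric]) (auto simp: F power_mult_distrib t4)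
  have e3: "theta3 q * theta3 q' = sqrt (ellF (k\<^sup>2) * ellF (k'\<^sup>2))"
    using pos by (intro real_sqrt_unique[symmetric]) (auto simp: F power_mult_distrib)
  have "is_min_value p (theta4 q * theta4 q')"
    unfolding is_min_value_def
  proof
    show "\<exists>z. p z = theta4 q * theta4 q'"
      \<comment> \<open>The minimum sits at the centre of the period cell, where each factor is a
        theta_4 value.\<close>
      by (rule exI[of _ "(1/2, 1/2)"]) (simp add: p theta4_jtheta)
    have "theta4 q * theta4 q' \<le> p (x, y)" for x y
      unfolding p using pos jtheta_0_min[OF q(1,2)] jtheta_0_min[OF q(3,4)] jtheta_0_pos[OF q(1,2)]
      by (intro mult_mono) (auto intro: less_imp_le)
    then show "\<forall>z. theta4 q * theta4 q' \<le> p z" by auto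
  qed
  moreover have "is_max_value p (theta3 q * theta3 q')"
    unfolding is_max_value_def
  proof
    show "\<exists>z. p z = theta3 q * theta3 q'"
      by (rule exI[of _ "(0, 0)"]) (simp add: p theta3_jtheta)
    have "p (x, y) \<le> theta3 q * theta3 q'" for x y
      unfolding p using pos jtheta_0_max[OF q(1,2)] jtheta_0_max[OF q(3,4)] jtheta_0_pos[OF q(3,4)]
      by (intro mult_mono) (auto intro: less_imp_le)
    then show "\<forall>z. p z \<le> theta3 q * theta3 q'" by auto
  qed
  moreover have "heat_kernel \<alpha> x y 1 \<in> \<real>" for x y
    by (simp only: heat_kernel_eq[OF assms(1)] Reals_of_real)
  moreover have "k\<^sup>2 + k'\<^sup>2 = 1"
    using modk_modk'[OF assms(1)] by (simp add: k_def k'_def)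
  ultimately show ?thesis
    using kr e2 e3 e4 bij_betw_modk' by simp
qed

end
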